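(* (a) For every $r\in[0;1)$ and every $z\in2^\omega$, the section $\{K\in\mathbf{K}:(K,z,0,r)\in\mathcal{A}_{\le}\}=\{K\in\mathbf{K}:\mu(K)\le r\}$ is $\boldsymbol{\Pi}^0_2$-complete, and hence its complement is $\boldsymbol{\Sigma}^0_2$-complete. Moreover $\mathcal{A}_\le$ is $\boldsymbol{\Pi}^0_2$-complete, $\mathcal{A}_>$ is $\boldsymbol{\Sigma}^0_2$-complete, and $\mathcal{A}$ is $\boldsymbol{\Pi}^0_2$-complete. (b) $\mathcal{B}^-_{\le}$ is $\boldsymbol{\Pi}^0_2$-complete, $\mathcal{B}^-_{\ge}$ is $\boldsymbol{\Pi}^0_3$-complete, $\mathcal{B}^-_{>}$ is $\boldsymbol{\Sigma}^0_2$-complete, $\mathcal{B}^-_<$ is $\boldsymbol{\Sigma}^0_3$-complete, and $\mathcal{B}$ is $\boldsymbol{\Pi}^0_3$-hard.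
   Context: $2^{\omega}$ is the Cantor space; $N_s=\{x\in2^\omega:s\subset x\}$; $\mu$ is the coin-tossing measure, $\mu(N_s)=2^{-\mathrm{lh}(s)}$. $\mathbf{K}$ is the Polish space of compact subsets of $2^\omega$ with the Vietoris topology. For compact $K$ and $z\in2^\omega$: $\mathcal{D}^+_K(z)=\limsup_n\mu(K\cap N_{z\restriction n})/\mu(N_{z\restriction n})$, $\mathcal{D}^-_K(z)=\liminf_n$ of the same ratios, and $\mathcal{D}_K(z)$ is the limit when it exists. For $\bowtie$ one of $<,>,\le,\ge$: $\mathcal{A}_\bowtie=\{(K,z,n,r)\in\mathbf{K}\times2^\omega\times\omega\times[0;1]:\mu(K\cap N_{z\restriction n})\bowtie r\}$, $\mathcal{A}=\{(K,z,n,r):\mu(K\cap N_{z\restriction n})=r\}$, $\mathcal{B}^\pm_\bowtie=\{(K,z,r)\in\mathbf{K}\times2^\omega\times[0;1]:\mathcal{D}^\pm_K(z)\bowtie r\}$, $\mathcal{B}=\{(K,z,r):\mathcal{D}_K(z)=r\}$ (with $\mathcal{D}_K(z)$ existing). $\omega$ is discrete. A set $A\subseteq X$ is $\boldsymbol{\Gamma}$-hard if for every zero-dimensional Polish $Z$ and $B\in\boldsymbol{\Gamma}(Z)$ there is continuous $f:Z\to X$ with $B=f^{-1}(A)$; $\boldsymbol{\Gamma}$-complete if moreover $A\in\boldsymbol{\Gamma}(X)$. *)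

theory Defs
  imports "HOL-Probability.Probability"
begin

definition cantor_top :: "(nat \<Rightarrow> bool) topology" where
  "cantor_top = product_topology (\<lambda>_::nat. discrete_topology (UNIV::bool set)) UNIV"

definition coin :: "(nat \<Rightarrow> bool) measure" where
  "coin = PiM (UNIV::nat set) (\<lambda>_. measure_pmf (bernoulli_pmf (1/2)))"

definition nbhd :: "(nat \<Rightarrow> bool) \<Rightarrow> nat \<Rightarrow> (nat \<Rightarrow> bool) set" where
  "nbhd z n = {x. \<forall>i<n. x i = z i}"

definition Kset :: "(nat \<Rightarrow> bool) set set" where
  "Kset = {K. compactin cantor_top K}"

definition vietoris :: "(nat \<Rightarrow> bool) set topology" where
  "vietoris = topology_generated_by
     ({{K \<in> Kset. K \<subseteq> U} | U. openin cantor_top U} \<union>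
      {{K \<in> Kset. K \<inter> U \<noteq> {}} | U. openin cantor_top U})"

definition omega_top :: "nat topology" where
  "omega_top = discrete_topology UNIV"

definition unit_top :: "real topology" where
  "unit_top = subtopology euclideanreal {0..1}"

definition spaceA :: "((nat \<Rightarrow> bool) set \<times> (nat \<Rightarrow> bool) \<times> nat \<times> real) topology" where
  "spaceA = prod_topology vietoris (prod_topology cantor_top (prod_topology omega_top unit_top))"

definition spaceB :: "((nat \<Rightarrow> bool) set \<times> (nat \<Rightarrow> bool) \<times> real) topology" where
  "spaceB = prod_topology vietoris (prod_topology cantor_top unit_top)"

definition A_le :: "((nat \<Rightarrow> bool) set \<times> (nat \<Rightarrow> bool) \<times> nat \<times> real) set" where
  "A_le = {(K, z, n, r). K \<in> Kset \<and> r \<in> {0..1} \<and> measure coin (K \<inter> nbhd z n) \<le> r}"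

definition A_gt :: "((nat \<Rightarrow> bool) set \<times> (nat \<Rightarrow> bool) \<times> nat \<times> real) set" where
  "A_gt = {(K, z, n, r). K \<in> Kset \<and> r \<in> {0..1} \<and> measure coin (K \<inter> nbhd z n) > r}"

definition A_eq :: "((nat \<Rightarrow> bool) set \<times> (nat \<Rightarrow> bool) \<times> nat \<times> real) set" where
  "A_eq = {(K, z, n, r). K \<in> Kset \<and> r \<in> {0..1} \<and> measure coin (K \<inter> nbhd z n) = r}"

definition dratio :: "(nat \<Rightarrow> bool) set \<Rightarrow> (nat \<Rightarrow> bool) \<Rightarrow> nat \<Rightarrow> real" where
  "dratio K z n = measure coin (K \<inter> nbhd z n) / measure coin (nbhd z n)"

definition lower_density :: "(nat \<Rightarrow> bool) set \<Rightarrow> (nat \<Rightarrow> bool) \<Rightarrow> ereal" where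
  "lower_density K z = liminf (\<lambda>n. ereal (dratio K z n))"

definition upper_density :: "(nat \<Rightarrow> bool) set \<Rightarrow> (nat \<Rightarrow> bool) \<Rightarrow> ereal" where
  "upper_density K z = limsup (\<lambda>n. ereal (dratio K z n))"

definition Bm_le :: "((nat \<Rightarrow> bool) set \<times> (nat \<Rightarrow> bool) \<times> real) set" where
  "Bm_le = {(K, z, r). K \<in> Kset \<and> r \<in> {0..1} \<and> lower_density K z \<le> ereal r}"

definition Bm_ge :: "((nat \<Rightarrow> bool) set \<times> (nat \<Rightarrow> bool) \<times> real) set" where
  "Bm_ge = {(K, z, r). K \<in> Kset \<and> r \<in> {0..1} \<and> lower_density K z \<ge> ereal r}"

definition Bm_gt :: "((nat \<Rightarrow> bool) set \<times> (nat \<Rightarrow> bool) \<times> real) set" where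
  "Bm_gt = {(K, z, r). K \<in> Kset \<and> r \<in> {0..1} \<and> lower_density K z > ereal r}"

definition Bm_lt :: "((nat \<Rightarrow> bool) set \<times> (nat \<Rightarrow> bool) \<times> real) set" where
  "Bm_lt = {(K, z, r). K \<in> Kset \<and> r \<in> {0..1} \<and> lower_density K z < ereal r}"

definition B_eq :: "((nat \<Rightarrow> bool) set \<times> (nat \<Rightarrow> bool) \<times> real) set" where
  "B_eq = {(K, z, r). K \<in> Kset \<and> r \<in> {0..1} \<and> (dratio K z \<longlonglongrightarrow> r)}"

fun Sigma0 :: "nat \<Rightarrow> 'a topology \<Rightarrow> 'a set set" where
  "Sigma0 0 X = {}"
| "Sigma0 (Suc 0) X = {S. openin X S}"
| "Sigma0 (Suc (Suc n)) X =
     {\<Union>i. A i | A. \<forall>i::nat. A i \<subseteq> topspace X \<and> topspace X - A i \<in> Sigma0 (Suc n) X}"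

definition Pi0 :: "nat \<Rightarrow> 'a topology \<Rightarrow> 'a set set" where
  "Pi0 n X = {topspace X - S | S. S \<in> Sigma0 n X}"

datatype bclass = Sig nat | Pic nat

fun bsets :: "bclass \<Rightarrow> 'a topology \<Rightarrow> 'a set set" where
  "bsets (Sig n) X = Sigma0 n X"
| "bsets (Pic n) X = Pi0 n X"

definition Polish_space :: "'a topology \<Rightarrow> bool" where
  "Polish_space X \<longleftrightarrow> separable_space X \<and> completely_metrizable_space X"

text \<open>Hardness: the spaces Z range over all zero-dimensional Polish spaces carried
  by the type 'z; the theorem is universally quantified over 'z.\<close>
definition hard :: "'z itself \<Rightarrow> bclass \<Rightarrow> 'a topology \<Rightarrow> 'a set \<Rightarrow> bool" where
  "hard (t::'z itself) G X A \<longleftrightarrow>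
     (\<forall>(Z::'z topology) B. Polish_space Z \<and> Z dim_le 0 \<and> B \<in> bsets G Z \<longrightarrow>
        (\<exists>f. continuous_map Z X f \<and> B = {x \<in> topspace Z. f x \<in> A}))"

definition bcomplete :: "'z itself \<Rightarrow> bclass \<Rightarrow> 'a topology \<Rightarrow> 'a set \<Rightarrow> bool" where
  "bcomplete t G X A \<longleftrightarrow> hard t G X A \<and> A \<in> bsets G X"

end

theory Submission
  imports Defs
begin

text \<open>
  Upper bounds: the measure of a compact \<open>K\<close> is the decreasing limit of the measures of its
  clopen thickenings, which are locally constant in the Vietoris topology. Hence
  \<open>K \<mapsto> \<mu>(K \<inter> N)\<close> is an infimum of countably many continuous functions, and counting
  quantifiers gives all the classes.

  Hardness: in a zero-dimensional Polish space a \<open>\<Pi>\<^sup>0\<^sub>2\<close> set has the form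
  \<open>{x. x \<in> P\<^sub>k for infinitely many k}\<close> with clopen \<open>P\<^sub>k\<close>. Forbidding the digit 1 at all
  places \<open>k\<close> with \<open>x \<in> P\<^sub>k\<close> yields a compact set that depends continuously on \<open>x\<close> and is null iff
  \<open>x\<close> lies in the given set. Placing such a set in one of the cylinders \<open>0\<^sup>k1\<close> and filling others
  according to the binary digits of \<open>r\<close> handles the bound \<open>r\<close>; placing it in all of
  them makes its measure the density at the zero sequence. For a \<open>\<Pi>\<^sup>0\<^sub>3\<close> set, given as
  \<open>{x. \<forall>n. x \<in> P n k for only finitely many k}\<close>, one removes a fraction \<open>1/2\<^sup>n\<^sup>+\<^sup>1\<close> of the cylinder
  coded by \<open>(n, k)\<close> whenever \<open>x \<in> P n k\<close>: the density at the zero sequence is then 1 if \<open>x\<close> lies in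
  the set, and the lower density is less than 1 otherwise.
\<close>

section \<open>Cylinders and the Vietoris topology\<close>

lemma mem_nbhd: "x \<in> nbhd z n \<longleftrightarrow> (\<forall>i<n. x i = z i)"
  by (simp add: nbhd_def)

lemma nbhd_refl [simp]: "x \<in> nbhd x n"
  by (simp add: mem_nbhd)

lemma nbhd_eq: "x \<in> nbhd z n \<Longrightarrow> nbhd x n = nbhd z n"
  by (auto simp: nbhd_def)

lemma nbhd_antimono: "m \<le> n \<Longrightarrow> nbhd x n \<subseteq> nbhd x m"
  by (auto simp: nbhd_def)

lemma nbhd_0 [simp]: "nbhd z 0 = UNIV"
  by (simp add: nbhd_def)

lemma topspace_cantor [simp]: "topspace cantor_top = UNIV"
  by (simp add: cantor_top_def)

lemma openin_nbhd: "openin cantor_top (nbhd z n)"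
proof -
  have "openin cantor_top (\<Pi>\<^sub>E i\<in>UNIV. if i < n then {z i} else UNIV)"
    unfolding cantor_top_def
    by (rule product_topology_basis) (auto intro: finite_subset[of _ "{..<n}"])
  also have "(\<Pi>\<^sub>E i\<in>UNIV. if i < n then {z i} else UNIV) = nbhd z n"
    by (auto simp: nbhd_def PiE_iff split: if_splits)
  finally show ?thesis .
qed

lemma openin_cantor: "openin cantor_top U \<longleftrightarrow> (\<forall>x\<in>U. \<exists>n. nbhd x n \<subseteq> U)"
proof
  assume U: "openin cantor_top U"
  show "\<forall>x\<in>U. \<exists>n. nbhd x n \<subseteq> U"
  proof
    fix x assume "x \<in> U"
    then obtain X where X: "x \<in> (\<Pi>\<^sub>E i\<in>UNIV. X i)" "finite {i. X i \<noteq> UNIV}"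
        "(\<Pi>\<^sub>E i\<in>UNIV. X i) \<subseteq> U"
      using product_topology_open_contains_basis[of "\<lambda>_. discrete_topology UNIV" UNIV U x] U
      by (auto simp: cantor_top_def)
    from X(2) obtain n where n: "{i. X i \<noteq> UNIV} \<subseteq> {..<n}"
      using finite_nat_iff_bounded by blast
    have "nbhd x n \<subseteq> (\<Pi>\<^sub>E i\<in>UNIV. X i)"
    proof
      fix y assume y: "y \<in> nbhd x n"
      have "y i \<in> X i" for i
        using n X(1) y by (cases "i < n") (fastforce simp: nbhd_def PiE_iff)+
      then show "y \<in> (\<Pi>\<^sub>E i\<in>UNIV. X i)" by auto
    qed
    then show "\<exists>n. nbhd x n \<subseteq> U" using X(3) by blast
  qed
next
  assume "\<forall>x\<in>U. \<exists>n. nbhd x n \<subseteq> U"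
  then show "openin cantor_top U"
    by (subst openin_subopen) (meson nbhd_refl openin_nbhd)
qed

lemma Kset_iff_closedin: "K \<in> Kset \<longleftrightarrow> closedin cantor_top K"
proof -
  have "compact_space cantor_top"
    unfolding cantor_top_def
    by (simp add: compact_space_product_topology compact_space_discrete_topology)
  moreover have "Hausdorff_space cantor_top"
    unfolding cantor_top_def by (simp add: Hausdorff_space_product_topology)
  ultimately show ?thesis
    unfolding Kset_def using closedin_compact_space compactin_imp_closedin by auto
qed

text \<open>Compactness is closedness because Cantor space is compact and Hausdorff, and closedness
  can be tested on cylinders. Later membership proofs for \<open>Kset\<close> mostly use this
  form.\<close>

lemma Kset_iff: "K \<in> Kset \<longleftrightarrow> (\<forall>x. (\<forall>n. \<exists>y\<in>K. y \<in> nbhd x n) \<longrightarrow> x \<in> K)"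
  unfolding Kset_iff_closedin closedin_def openin_cantor by (simp add: subset_iff) blast

text \<open>The clopen set obtained by reading \<open>K\<close> only up to level \<open>n\<close>;
  it amounts to the set of words of length \<open>n\<close> in the tree of \<open>K\<close>.\<close>

definition thick :: "nat \<Rightarrow> (nat \<Rightarrow> bool) set \<Rightarrow> (nat \<Rightarrow> bool) set" where
  "thick n K = (\<Union>y\<in>K. nbhd y n)"

lemma mem_thick: "x \<in> thick n K \<longleftrightarrow> (\<exists>y\<in>K. \<forall>i<n. x i = y i)"
  by (auto simp: thick_def nbhd_def)

lemma subset_thick: "K \<subseteq> thick n K"
  by (auto simp: mem_thick)

lemma thick_antimono: "m \<le> n \<Longrightarrow> thick n K \<subseteq> thick m K"
  using nbhd_antimono by (fastforce simp: thick_def)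

text \<open>Agreement on the first \<open>n\<close> digits is an equivalence relation, so thickening
  again at the same level adds nothing.\<close>

lemma thick_thick_subset: "K \<subseteq> thick n L \<Longrightarrow> thick n K \<subseteq> thick n L"
proof
  fix x assume L: "K \<subseteq> thick n L" and "x \<in> thick n K"
  then obtain y where y: "y \<in> K" "\<forall>i<n. x i = y i" by (auto simp: mem_thick)
  then have "y \<in> thick n L" using L by blast
  then show "x \<in> thick n L" using y by (auto simp: mem_thick)
qed

lemma openin_thick: "openin cantor_top (thick n K)"
  unfolding thick_def using openin_nbhd by blast

lemma Inter_thick: "K \<in> Kset \<Longrightarrow> (\<Inter>n. thick n K) = K"
proof (intro equalityI subsetI)
  fix x assume "K \<in> Kset" and x: "x \<in> (\<Inter>n. thick n K)"
  have "\<exists>y\<in>K. y \<in> nbhd x n" for n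
  proof -
    have "x \<in> thick n K" using x by blast
    then show ?thesis by (auto simp: mem_thick mem_nbhd)
  qed
  then show "x \<in> K" using \<open>K \<in> Kset\<close> Kset_iff by blast
qed (use subset_thick in blast)

text \<open>The number \<open>n\<close> plays the role of a Lebesgue number of the cover \<open>{U}\<close> of \<open>K\<close>.\<close>
lemma thick_subset_open:
  assumes "K \<in> Kset" "openin cantor_top U" "K \<subseteq> U"
  obtains n where "thick n K \<subseteq> U"
proof -
  have "\<exists>k. \<forall>y\<in>K. nbhd y k \<subseteq> U"
  proof -
    define \<U> where "\<U> = {nbhd y n | y n. y \<in> K \<and> nbhd y n \<subseteq> U}"
    have "K \<subseteq> \<Union>\<U>"
    proof
      fix y assume y: "y \<in> K"
      then obtain n where "nbhd y n \<subseteq> U"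
        using assms(2,3) openin_cantor by blast
      then show "y \<in> \<Union>\<U>" using y nbhd_refl unfolding \<U>_def by blast
    qed
    moreover have "\<forall>V\<in>\<U>. openin cantor_top V"
      by (auto simp: \<U>_def openin_nbhd)
    ultimately obtain \<F> where \<F>: "finite \<F>" "\<F> \<subseteq> \<U>" "K \<subseteq> \<Union>\<F>"
      using assms(1) unfolding Kset_def compactin_def by auto
    have "\<exists>n. \<forall>x\<in>V. nbhd x n \<subseteq> U" if V: "V \<in> \<F>" for V
    proof -
      obtain y n where "V = nbhd y n" "nbhd y n \<subseteq> U" using \<F>(2) V unfolding \<U>_def by blast
      then have "\<forall>x\<in>V. nbhd x n \<subseteq> U" using nbhd_eq[of _ y n] by blast
      then show ?thesis ..
    qed
    then obtain N where N: "\<And>V x. V \<in> \<F> \<Longrightarrow> x \<in> V \<Longrightarrow> nbhd x (N V) \<subseteq> U"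
      by metis
    have "nbhd y (Max (N ` \<F>)) \<subseteq> U" if y: "y \<in> K" for y
    proof -
      obtain V where V: "V \<in> \<F>" "y \<in> V" using y \<F>(3) by blast
      then have "N V \<le> Max (N ` \<F>)" using \<F>(1) by simp
      then show ?thesis using N[OF V] nbhd_antimono by blast
    qed
    then show ?thesis by blast
  qed
  then show ?thesis using that unfolding thick_def by blast
qed

section \<open>The Vietoris topology in terms of thickenings\<close>

lemma topspace_vietoris [simp]: "topspace vietoris = Kset"
  unfolding vietoris_def topology_generated_by_topspace using openin_topspace[of cantor_top]
  by (auto simp del: openin_topspace)

lemma openin_vietoris_subset: "openin cantor_top U \<Longrightarrow> openin vietoris {K \<in> Kset. K \<subseteq> U}"
  unfolding vietoris_def by (rule topology_generated_by_Basis) blast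

lemma openin_vietoris_meets: "openin cantor_top U \<Longrightarrow> openin vietoris {K \<in> Kset. K \<inter> U \<noteq> {}}"
  unfolding vietoris_def by (rule topology_generated_by_Basis) blast

text \<open>Membership of \<open>f x\<close> in a subbasic set is decided by a sufficiently fine
  thickening: for \<open>K \<subseteq> U\<close> compactness provides the level, for
  \<open>K \<inter> U \<noteq> {}\<close> a cylinder inside \<open>U\<close> does. So local
  constancy of every thickening yields continuity.\<close>

lemma continuous_map_vietorisI:
  assumes K: "\<And>x. x \<in> topspace Z \<Longrightarrow> f x \<in> Kset"
    and thick: "\<And>x n. x \<in> topspace Z \<Longrightarrow>
      \<exists>U. openin Z U \<and> x \<in> U \<and> (\<forall>x'\<in>U. thick n (f x') = thick n (f x))"
  shows "continuous_map Z vietoris f"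
  unfolding vietoris_def
proof (rule continuous_on_generated_topo)
  fix W
  assume W: "W \<in> {{K \<in> Kset. K \<subseteq> U} |U. openin cantor_top U} \<union>
                 {{K \<in> Kset. K \<inter> U \<noteq> {}} |U. openin cantor_top U}"
  have "\<exists>V. openin Z V \<and> x \<in> V \<and> V \<subseteq> f -` W \<inter> topspace Z" 
    if x: "x \<in> f -` W \<inter> topspace Z" for x
  proof -
    from W consider U where "openin cantor_top U" "W = {K \<in> Kset. K \<subseteq> U}"
      | U where "openin cantor_top U" "W = {K \<in> Kset. K \<inter> U \<noteq> {}}" by blast
    then have "\<exists>n. \<forall>x'\<in>topspace Z. thick n (f x') = thick n (f x) \<longrightarrow> f x' \<in> W"
    proof cases
      case 1
      then obtain n where "thick n (f x) \<subseteq> U"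
        using thick_subset_open x by (metis (no_types, lifting) IntD1 mem_Collect_eq vimageE)
      then show ?thesis using 1 K subset_thick by blast
    next
      case 2
      then obtain y where y: "y \<in> f x" "y \<in> U" using x by blast
      then obtain n where n: "nbhd y n \<subseteq> U" using 2 openin_cantor by blast
      have "f x' \<in> W" if "x' \<in> topspace Z" "thick n (f x') = thick n (f x)" for x'
      proof -
        have "y \<in> thick n (f x')" using that y subset_thick by blast
        then obtain y' where "y' \<in> f x'" "y' \<in> nbhd y n" by (auto simp: mem_thick mem_nbhd)
        then show ?thesis using n 2 K that by blast
      qed
      then show ?thesis by blast
    qed
    then obtain n where n: "\<And>x'. x' \<in> topspace Z \<Longrightarrow> thick n (f x') = thick n (f x) \<Longrightarrow> f x' \<in> W"
      by blast
    obtain U where U: "openin Z U" "x \<in> U" "\<forall>x'\<in>U. thick n (f x') = thick n (f x)"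
      using thick[of x n] x by auto
    have "U \<subseteq> f -` W \<inter> topspace Z"
    proof
      fix x' assume "x' \<in> U"
      then have "x' \<in> topspace Z" "thick n (f x') = thick n (f x)"
        using U(3) openin_subset[OF U(1)] by blast+
      then show "x' \<in> f -` W \<inter> topspace Z" using n by simp
    qed
    then show ?thesis using U(1,2) by blast
  qed
  then show "openin Z (f -` W \<inter> topspace Z)"
    by (subst openin_subopen) blast
next
  show "f ` topspace Z \<subseteq> \<Union> ({{K \<in> Kset. K \<subseteq> U} |U. openin cantor_top U} \<union>
                 {{K \<in> Kset. K \<inter> U \<noteq> {}} |U. openin cantor_top U})"
    using K topspace_vietoris unfolding vietoris_def topology_generated_by_topspace by blast
qed

lemma finite_range_nbhd: "finite (range (\<lambda>y. nbhd y n))"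
proof -
  have "range (\<lambda>y. nbhd y n) \<subseteq> (\<lambda>y. nbhd y n) ` {y. \<forall>i. \<not> i < n \<longrightarrow> \<not> y i}"
  proof
    fix V assume "V \<in> range (\<lambda>y. nbhd y n)"
    then obtain y where "V = nbhd y n" by blast
    \<comment> \<open>A cylinder only knows a word of length \<open>n\<close>; padding the word with
      \<open>False\<close> picks its centre from a finite set.\<close>
    then have "V = nbhd (\<lambda>i. i < n \<and> y i) n" by (auto simp: nbhd_def)
    then show "V \<in> (\<lambda>y. nbhd y n) ` {y. \<forall>i. \<not> i < n \<longrightarrow> \<not> y i}" by auto
  qed
  moreover have "finite {y::nat \<Rightarrow> bool. \<forall>i. (i \<in> {..<n} \<longrightarrow> y i \<in> UNIV) \<and> (i \<notin> {..<n} \<longrightarrow> y i = False)}"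
    by (rule finite_set_of_finite_funs) auto
  then have "finite {y::nat \<Rightarrow> bool. \<forall>i. \<not> i < n \<longrightarrow> \<not> y i}" by simp
  ultimately show ?thesis using finite_surj by blast
qed

text \<open>Equal thickenings mean that each set lies in the thickening of the other. One inclusion
  is a subbasic condition on \<open>L\<close>, the other says that \<open>L\<close> meets each of
  finitely many cylinders, so the set is a finite intersection of open sets.\<close>

lemma openin_vietoris_thick_eq:
  assumes "K \<in> Kset"
  shows "openin vietoris {L \<in> Kset. thick n L = thick n K}"
proof -
  let ?F = "(\<lambda>y. nbhd y n) ` K"
  have "finite ?F" by (rule finite_subset[OF _ finite_range_nbhd[of n]]) auto
  \<comment> \<open>The intersection with the whole space takes care of empty \<open>K\<close>,
    where the family \<open>?F\<close> is empty.\<close>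
  then have "openin vietoris ((\<Inter>V\<in>?F. {L \<in> Kset. L \<inter> V \<noteq> {}}) \<inter> topspace vietoris)"
  proof (rule openin_INT)
    fix V assume "V \<in> ?F"
    then obtain y where "V = nbhd y n" by blast
    then show "openin vietoris {L \<in> Kset. L \<inter> V \<noteq> {}}"
      using openin_vietoris_meets[OF openin_nbhd[of y n]] by simp
  qed
  then have "openin vietoris ({L \<in> Kset. L \<subseteq> thick n K} \<inter>
      ((\<Inter>V\<in>?F. {L \<in> Kset. L \<inter> V \<noteq> {}}) \<inter> topspace vietoris))"
    by (rule openin_Int[OF openin_vietoris_subset[OF openin_thick]])
  also have "{L \<in> Kset. L \<subseteq> thick n K} \<inter> ((\<Inter>V\<in>?F. {L \<in> Kset. L \<inter> V \<noteq> {}}) \<inter> topspace vietoris)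
      = {L \<in> Kset. thick n L = thick n K}" (is "?A = ?B")
  proof (rule set_eqI)
    fix L
    have "(\<forall>y\<in>K. L \<inter> nbhd y n \<noteq> {}) \<longleftrightarrow> K \<subseteq> thick n L"
    proof -
      have "L \<inter> nbhd y n \<noteq> {} \<longleftrightarrow> y \<in> thick n L" for y
        by (auto simp: mem_thick mem_nbhd disjoint_iff)
      then show ?thesis by blast
    qed
    then have "L \<in> ?A \<longleftrightarrow> L \<in> Kset \<and> L \<subseteq> thick n K \<and> K \<subseteq> thick n L" by auto
    also have "\<dots> \<longleftrightarrow> L \<in> ?B"
      using thick_thick_subset subset_thick by blast
    finally show "L \<in> ?A \<longleftrightarrow> L \<in> ?B" .
  qed
  finally show ?thesis .
qed

section \<open>The coin-tossing measure\<close>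

interpretation coin: sequence_space "measure_pmf (bernoulli_pmf (1/2))"
  rewrites "PiM (UNIV::nat set) (\<lambda>_. measure_pmf (bernoulli_pmf (1/2))) = coin"
  by unfold_locales (simp add: coin_def)

lemma space_coin [simp]: "space coin = UNIV"
  by (simp add: coin_def space_PiM)

lemma measure_coin_UNIV [simp]: "measure coin UNIV = 1"
  using coin.P.prob_space by simp

text \<open>Each coordinate in \<open>J\<close> contributes an independent factor 1/2. Arbitrary
  finite \<open>J\<close> are allowed because both cylinders and \<open>zeros_on\<close> are
  measured this way.\<close>

lemma
  assumes "finite J"
  shows measure_coin_finite: "measure coin {y. \<forall>i\<in>J. y i = z i} = (1/2) ^ card J"
    and sets_coin_finite: "{y. \<forall>i\<in>J. y i = z i} \<in> sets coin"
proof -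
  let ?M = "measure_pmf (bernoulli_pmf (1/2))"
  have emb: "{y. \<forall>i\<in>J. y i = z i} = prod_emb UNIV (\<lambda>_. ?M) J (\<Pi>\<^sub>E i\<in>J. {z i})"
  proof (rule set_eqI)
    fix y :: "nat \<Rightarrow> bool"
    have "restrict y J \<in> (\<Pi>\<^sub>E i\<in>J. {z i}) \<longleftrightarrow> (\<forall>i\<in>J. y i = z i)"
      unfolding PiE_iff by (simp only: restrict_extensional restrict_apply singleton_iff) simp
    then show "y \<in> {y. \<forall>i\<in>J. y i = z i} \<longleftrightarrow>
        y \<in> prod_emb UNIV (\<lambda>_. ?M) J (\<Pi>\<^sub>E i\<in>J. {z i})"
      by (simp only: prod_emb_iff) simp
  qed
  have half: "measure ?M {b} = 1/2" for b
    by (cases b) (simp_all add: measure_pmf_single)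
  have "measure coin {y. \<forall>i\<in>J. y i = z i} = (\<Prod>i\<in>J. measure ?M {z i})"
    unfolding emb by (rule coin.measure_PiM_emb) (simp_all add: assms)
  then show "measure coin {y. \<forall>i\<in>J. y i = z i} = (1/2) ^ card J"
    by (simp only: half prod_constant)
  show "{y. \<forall>i\<in>J. y i = z i} \<in> sets coin"
    unfolding emb coin_def by (rule sets_PiM_I) (simp_all add: assms)
qed

lemma nbhd_alt: "nbhd z n = {y. \<forall>i\<in>{..<n}. y i = z i}"
  by (auto simp: nbhd_def)

lemma measure_nbhd: "measure coin (nbhd z n) = (1/2) ^ n"
  unfolding nbhd_alt using measure_coin_finite[of "{..<n}" z] by simp

lemma sets_nbhd [measurable]: "nbhd z n \<in> sets coin"
  unfolding nbhd_alt by (intro sets_coin_finite) simp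

lemma sets_thick [measurable]: "thick n K \<in> sets coin"
proof -
  have "finite ((\<lambda>y. nbhd y n) ` K)"
    by (rule finite_subset[OF _ finite_range_nbhd[of n]]) auto
  then have "\<Union>((\<lambda>y. nbhd y n) ` K) \<in> sets coin"
    by (rule sets.finite_Union) auto
  then show ?thesis by (simp add: thick_def)
qed

lemma sets_Kset:
  assumes "K \<in> Kset"
  shows "K \<in> sets coin"
proof -
  have "(\<Inter>n. thick n K) \<in> sets coin" by measurable
  then show ?thesis using Inter_thick[OF assms] by simp
qed

lemma measure_thick_tendsto:
  assumes "K \<in> Kset" "A \<in> sets coin"
  shows "(\<lambda>m. measure coin (thick m K \<inter> A)) \<longlonglongrightarrow> measure coin (K \<inter> A)"
proof -
  have "(\<lambda>m. measure coin (thick m K \<inter> A)) \<longlonglongrightarrow> measure coin (\<Inter>m. thick m K \<inter> A)"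
    using assms(2) thick_antimono
    by (intro coin.finite_Lim_measure_decseq) (auto simp: decseq_def)
  also have "(\<Inter>m. thick m K \<inter> A) = K \<inter> A"
    using Inter_thick[OF assms(1)] by blast
  finally show ?thesis .
qed

text \<open>Upper semicontinuity in countable form: by continuity from above the measure is the
  infimum of the measures of the thickenings, so a strict upper bound is witnessed at a finite
  level. All upper bounds on complexity rest on this.\<close>

lemma measure_less_iff_thick:
  assumes "K \<in> Kset" "A \<in> sets coin"
  shows "measure coin (K \<inter> A) < c \<longleftrightarrow> (\<exists>m. measure coin (thick m K \<inter> A) < c)"
proof
  assume "measure coin (K \<inter> A) < c"
  then have "\<forall>\<^sub>F m in sequentially. measure coin (thick m K \<inter> A) < c"
    by (rule order_tendstoD(2)[OF measure_thick_tendsto[OF assms]])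
  then show "\<exists>m. measure coin (thick m K \<inter> A) < c"
    by (meson eventually_sequentially order_refl)
next
  assume "\<exists>m. measure coin (thick m K \<inter> A) < c"
  then obtain m where "measure coin (thick m K \<inter> A) < c" ..
  moreover have "measure coin (K \<inter> A) \<le> measure coin (thick m K \<inter> A)"
    using assms subset_thick by (intro coin.finite_measure_mono) auto
  ultimately show "measure coin (K \<inter> A) < c" by simp
qed

definition cons_set :: "bool \<Rightarrow> (nat \<Rightarrow> bool) set \<Rightarrow> (nat \<Rightarrow> bool) set" where
  "cons_set b A = {y. y 0 = b \<and> (\<lambda>i. y (Suc i)) \<in> A}"

text \<open>A random sequence is a first toss followed by an independent sequence of the same law.
  Along this splitting \<open>cons_set b A\<close> pulls back to the rectangle
  \<open>{b} \<times> A\<close>.\<close>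

lemma
  assumes "A \<in> sets coin"
  shows measure_cons_set: "measure coin (cons_set b A) = measure coin A / 2"
    and sets_cons_set: "cons_set b A \<in> sets coin"
proof -
  let ?M = "measure_pmf (bernoulli_pmf (1/2))"
  have "(\<lambda>y i. y (Suc i)) \<in> measurable coin coin"
    unfolding coin_def by (rule measurable_PiM_single') (auto simp: space_PiM)
  then have "(\<lambda>y i. y (Suc i)) -` A \<inter> space coin \<in> sets coin"
    using assms by (rule measurable_sets)
  moreover have "{y. \<forall>i\<in>{0}. y i = b} \<in> sets coin" by (rule sets_coin_finite) simp
  ultimately have "{y. \<forall>i\<in>{0}. y i = b} \<inter> ((\<lambda>y i. y (Suc i)) -` A \<inter> space coin) \<in> sets coin"
    by blast
  also have "{y. \<forall>i\<in>{0}. y i = b} \<inter> ((\<lambda>y i. y (Suc i)) -` A \<inter> space coin) = cons_set b A"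
    by (auto simp: cons_set_def)
  finally show S: "cons_set b A \<in> sets coin" .
  have meas: "(\<lambda>(s, \<omega>). case_nat s \<omega>) \<in> measurable (?M \<Otimes>\<^sub>M coin) coin"
    unfolding coin_def by measurable
  have "measure coin (cons_set b A)
      = measure (distr (?M \<Otimes>\<^sub>M coin) coin (\<lambda>(s, \<omega>). case_nat s \<omega>)) (cons_set b A)"
    using coin.PiM_iter by simp
  also have "\<dots> = measure (?M \<Otimes>\<^sub>M coin) ((\<lambda>(s, \<omega>). case_nat s \<omega>) -` cons_set b A \<inter> space (?M \<Otimes>\<^sub>M coin))"
    using meas S by (rule measure_distr)
  also have "(\<lambda>(s, \<omega>). case_nat s \<omega>) -` cons_set b A \<inter> space (?M \<Otimes>\<^sub>M coin) = {b} \<times> A"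
    by (auto simp: cons_set_def space_pair_measure)
  also have "measure (?M \<Otimes>\<^sub>M coin) ({b} \<times> A) = measure ?M {b} * measure coin A"
    using assms by (simp add: measure_def coin.P.emeasure_pair_measure_Times enn2real_mult)
  also have "measure ?M {b} = 1/2"
    by (cases b) (simp_all add: measure_pmf_single)
  finally show "measure coin (cons_set b A) = measure coin A / 2" by simp
qed

section \<open>Test sets: forbidden digits, and blocks accumulating at the zero sequence\<close>

definition zeros_on :: "nat set \<Rightarrow> (nat \<Rightarrow> bool) set" where
  "zeros_on S = {y. \<forall>i\<in>S. \<not> y i}"

lemma zeros_on_Kset: "zeros_on S \<in> Kset"
  unfolding Kset_iff zeros_on_def nbhd_def by simp (metis lessI)

text \<open>Every forbidden place halves the measure: \<open>n\<close> places of an infinite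
  \<open>S\<close> bound it by \<open>(1/2) ^ n\<close>, whereas a finite \<open>S\<close> leaves a
  positive power of 1/2.\<close>

lemma measure_zeros_on_le: "measure coin (zeros_on S) \<le> 0 \<longleftrightarrow> infinite S"
proof
  assume le: "measure coin (zeros_on S) \<le> 0"
  show "infinite S"
  proof
    assume "finite S"
    then have "measure coin (zeros_on S) = (1/2) ^ card S"
      using measure_coin_finite[of S "\<lambda>_. False"] by (simp add: zeros_on_def)
    moreover have "0 < (1/2::real) ^ card S" by simp
    ultimately show False using le by linarith
  qed
next
  assume inf: "infinite S"
  have "measure coin (zeros_on S) \<le> (1/2) ^ n" for n
  proof -
    obtain T where T: "finite T" "card T = n" "T \<subseteq> S"
      using infinite_arbitrarily_large[OF inf] by blast
    have "measure coin (zeros_on S) \<le> measure coin (zeros_on T)"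
      using T by (intro coin.finite_measure_mono sets_Kset zeros_on_Kset) (auto simp: zeros_on_def)
    then show ?thesis
      using measure_coin_finite[of T "\<lambda>_. False"] T by (simp add: zeros_on_def)
  qed
  moreover have "(\<lambda>n. (1/2::real) ^ n) \<longlonglongrightarrow> 0"
    by (simp add: LIMSEQ_power_zero)
  ultimately show "measure coin (zeros_on S) \<le> 0"
    by (intro LIMSEQ_le_const) auto
qed

text \<open>The sets \<open>K k\<close> are placed in the disjoint cylinders \<open>0\<^sup>k1\<close>, which accumulate only at
  the zero sequence.\<close>
definition glue :: "(nat \<Rightarrow> (nat \<Rightarrow> bool) set) \<Rightarrow> (nat \<Rightarrow> bool) set" where
  "glue K = {y. \<forall>k. y k \<and> (\<forall>i<k. \<not> y i) \<longrightarrow> (\<lambda>i. y (Suc k + i)) \<in> K k}"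

abbreviation zero_seq :: "nat \<Rightarrow> bool" where
  "zero_seq \<equiv> \<lambda>_. False"

lemma glue_Kset:
  assumes "\<And>k. K k \<in> Kset"
  shows "glue K \<in> Kset"
  unfolding Kset_iff
proof (intro allI impI)
  fix x assume x: "\<forall>n. \<exists>y\<in>glue K. y \<in> nbhd x n"
  have "(\<lambda>i. x (Suc k + i)) \<in> K k" if k: "x k" "\<forall>i<k. \<not> x i" for k
  proof -
    have "\<exists>y\<in>K k. y \<in> nbhd (\<lambda>i. x (Suc k + i)) n" for n
    proof -
      obtain y where y: "y \<in> glue K" "\<forall>i<Suc k + n. y i = x i"
        using x[rule_format, of "Suc k + n"] by (auto simp: nbhd_def)
      then have "y k \<and> (\<forall>i<k. \<not> y i)" using k by auto
      then have "(\<lambda>i. y (Suc k + i)) \<in> K k" using y(1) by (simp add: glue_def)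
      then show ?thesis using y(2) by (intro bexI[of _ "\<lambda>i. y (Suc k + i)"]) (auto simp: nbhd_def)
    qed
    then show ?thesis using assms[of k] unfolding Kset_iff by blast
  qed
  then show "x \<in> glue K" by (simp add: glue_def)
qed

text \<open>The first digit decides: after a 1 the tail is tested against block 0, after a 0 it
  faces the same task with the blocks shifted by one.\<close>

lemma glue_unfold: "glue K = cons_set True (K 0) \<union> cons_set False (glue (\<lambda>k. K (Suc k)))"
proof (rule set_eqI)
  fix y :: "nat \<Rightarrow> bool"
  let ?P = "\<lambda>k. y k \<and> (\<forall>i<k. \<not> y i) \<longrightarrow> (\<lambda>i. y (Suc k + i)) \<in> K k"
  have "(\<forall>k. ?P k) \<longleftrightarrow> ?P 0 \<and> (\<forall>k. ?P (Suc k))"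
    by (metis not0_implies_Suc)
  then show "y \<in> glue K \<longleftrightarrow> y \<in> cons_set True (K 0) \<union> cons_set False (glue (\<lambda>k. K (Suc k)))"
    by (cases "y 0") (auto simp: glue_def cons_set_def All_less_Suc2)
qed

lemma measure_glue_rec:
  assumes "\<And>k. K k \<in> Kset"
  shows "measure coin (glue K) = measure coin (K 0) / 2 + measure coin (glue (\<lambda>k. K (Suc k))) / 2"
proof -
  have "K 0 \<in> sets coin" "glue (\<lambda>k. K (Suc k)) \<in> sets coin"
    using assms by (auto intro!: sets_Kset glue_Kset)
  then show ?thesis
    unfolding glue_unfold[of K]
    by (subst coin.finite_measure_Union) (auto simp: measure_cons_set sets_cons_set, auto simp: cons_set_def)
qed

text \<open>Block \<open>k\<close> has the weight of its cylinder, 1/2^(k+1). Unrolling the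
  recursion \<open>n\<close> times leaves a remainder of at most \<open>(1/2) ^ n\<close>.\<close>

lemma measure_glue_sums:
  assumes "\<And>k. K k \<in> Kset"
  shows "(\<lambda>k. measure coin (K k) / 2 ^ Suc k) sums measure coin (glue K)"
proof -
  have *: "measure coin (glue K) = (\<Sum>k<n. measure coin (K k) / 2 ^ Suc k)
      + measure coin (glue (\<lambda>k. K (n + k))) / 2 ^ n" for n
  proof (induction n)
    case (Suc n)
    then show ?case
      using measure_glue_rec[of "\<lambda>k. K (n + k)"] assms by (simp add: field_simps)
  qed simp
  have "(\<lambda>n. measure coin (glue (\<lambda>k. K (n + k))) / 2 ^ n) \<longlonglongrightarrow> 0"
  proof (rule tendsto_sandwich)
    show "\<forall>\<^sub>F n in sequentially. 0 \<le> measure coin (glue (\<lambda>k. K (n + k))) / 2 ^ n" by simp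
    show "\<forall>\<^sub>F n in sequentially. measure coin (glue (\<lambda>k. K (n + k))) / 2 ^ n \<le> (1/2) ^ n"
      using coin.prob_le_1 by (intro always_eventually allI) (simp add: power_one_over divide_right_mono)
    show "(\<lambda>n. (1/2::real) ^ n) \<longlonglongrightarrow> 0" by (simp add: LIMSEQ_power_zero)
  qed simp
  then have "(\<lambda>n. measure coin (glue K) - measure coin (glue (\<lambda>k. K (n + k))) / 2 ^ n)
      \<longlonglongrightarrow> measure coin (glue K) - 0"
    by (intro tendsto_intros)
  moreover have "measure coin (glue K) - measure coin (glue (\<lambda>k. K (n + k))) / 2 ^ n
      = (\<Sum>k<n. measure coin (K k) / 2 ^ Suc k)" for n
    using *[of n] by simp
  ultimately show ?thesis unfolding sums_def by simp
qed

lemma measure_glue_nbhd: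
  assumes "\<And>k. K k \<in> Kset"
  shows "measure coin (glue K \<inter> nbhd zero_seq n) = measure coin (glue (\<lambda>k. K (n + k))) / 2 ^ n"
  using assms
proof (induction n arbitrary: K)
  case (Suc n)
  let ?L = "glue (\<lambda>k. K (Suc k)) \<inter> nbhd zero_seq n"
  have "?L \<in> sets coin"
    using Suc.prems by (intro sets.Int sets_Kset glue_Kset sets_nbhd)
  moreover have "glue K \<inter> nbhd zero_seq (Suc n) = cons_set False ?L"
    unfolding glue_unfold[of K] by (auto simp: cons_set_def nbhd_def All_less_Suc2)
  ultimately have "measure coin (glue K \<inter> nbhd zero_seq (Suc n)) = measure coin ?L / 2"
    by (simp add: measure_cons_set)
  then show ?case using Suc.IH[of "\<lambda>k. K (Suc k)"] Suc.prems by simp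
qed simp

text \<open>Glueing is self-similar at the zero sequence: zooming into
  \<open>nbhd zero_seq n\<close> drops the first \<open>n\<close> blocks, and the factor 1/2^n
  cancels against the measure of the cylinder. Densities thus become measures of tails.\<close>

lemma dratio_glue:
  assumes "\<And>k. K k \<in> Kset"
  shows "dratio (glue K) zero_seq n = measure coin (glue (\<lambda>k. K (n + k)))"
  using measure_glue_nbhd[OF assms] by (simp add: dratio_def measure_nbhd power_one_over)

section \<open>Borel classes and reductions\<close>

declare Sigma0.simps(3) [simp del]

lemma Sigma0_subset: "S \<in> Sigma0 n X \<Longrightarrow> S \<subseteq> topspace X"
proof (cases "(n, X)" rule: Sigma0.cases)
  case (2 Y)
  then show "S \<in> Sigma0 n X \<Longrightarrow> S \<subseteq> topspace X" using openin_subset[of X S] by simp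
next
  case (3 m Y)
  then have n: "n = Suc (Suc m)" by simp
  show "S \<in> Sigma0 n X \<Longrightarrow> S \<subseteq> topspace X" unfolding n Sigma0.simps by blast
qed simp

lemma Pi0_iff: "S \<in> Pi0 n X \<longleftrightarrow> S \<subseteq> topspace X \<and> topspace X - S \<in> Sigma0 n X"
proof
  assume "S \<in> Pi0 n X"
  then obtain T where "S = topspace X - T" "T \<in> Sigma0 n X" by (auto simp: Pi0_def)
  then show "S \<subseteq> topspace X \<and> topspace X - S \<in> Sigma0 n X"
    using Sigma0_subset[of T n X] by (simp add: double_diff)
next
  assume "S \<subseteq> topspace X \<and> topspace X - S \<in> Sigma0 n X"
  then show "S \<in> Pi0 n X"
    unfolding Pi0_def by (intro CollectI exI[of _ "topspace X - S"]) auto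
qed

lemma Sigma0_iff: "S \<in> Sigma0 n X \<longleftrightarrow> S \<subseteq> topspace X \<and> topspace X - S \<in> Pi0 n X"
proof (cases "S \<subseteq> topspace X")
  case True
  then have "topspace X - (topspace X - S) = S" by blast
  then show ?thesis using True by (simp add: Pi0_iff)
next
  case False
  then show ?thesis using Sigma0_subset[of S n X] by blast
qed

lemma Sigma0_Suc_Suc: "S \<in> Sigma0 (Suc (Suc n)) X \<longleftrightarrow> (\<exists>A. S = (\<Union>i::nat. A i) \<and> (\<forall>i. A i \<in> Pi0 (Suc n) X))"
  unfolding Pi0_iff Sigma0.simps mem_Collect_eq by (rule refl)

lemma Pi0_Suc_Suc: "S \<in> Pi0 (Suc (Suc n)) X \<longleftrightarrow>
   S \<subseteq> topspace X \<and> (\<exists>U. S = topspace X \<inter> (\<Inter>i::nat. U i) \<and> (\<forall>i. U i \<in> Sigma0 (Suc n) X))"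
proof (intro iffI conjI)
  assume S: "S \<in> Pi0 (Suc (Suc n)) X"
  then obtain A where A: "topspace X - S = (\<Union>i::nat. A i)" "\<And>i. A i \<in> Pi0 (Suc n) X"
    unfolding Pi0_iff[of S] Sigma0_Suc_Suc by blast
  show sub: "S \<subseteq> topspace X" using S by (simp add: Pi0_iff)
  have "S = topspace X \<inter> (\<Inter>i. topspace X - A i)" using A(1) sub by blast
  then show "\<exists>U. S = topspace X \<inter> (\<Inter>i::nat. U i) \<and> (\<forall>i. U i \<in> Sigma0 (Suc n) X)"
    using A(2) Pi0_iff by (intro exI[of _ "\<lambda>i. topspace X - A i"]) blast
next
  assume "S \<subseteq> topspace X \<and> (\<exists>U. S = topspace X \<inter> (\<Inter>i::nat. U i) \<and> (\<forall>i. U i \<in> Sigma0 (Suc n) X))"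
  then obtain U where sub: "S \<subseteq> topspace X" and U: "S = topspace X \<inter> (\<Inter>i::nat. U i)"
      "\<And>i. U i \<in> Sigma0 (Suc n) X" by blast
  have "topspace X - S = (\<Union>i. topspace X - U i)" using U(1) by blast
  then show "S \<in> Pi0 (Suc (Suc n)) X"
    unfolding Pi0_iff[of S] Sigma0_Suc_Suc using sub U(2) Sigma0_iff
    by (intro conjI exI[of _ "\<lambda>i. topspace X - U i"]) blast+
qed

text \<open>The index set may be any nonempty countable set, such as pairs or a sum type; it is
  enumerated with possible repetitions, which is where nonemptiness enters.\<close>

lemma Sigma0_countable_Union:
  assumes "countable I" "I \<noteq> {}" "\<And>i. i \<in> I \<Longrightarrow> A i \<in> Pi0 (Suc n) X"
  shows "(\<Union>i\<in>I. A i) \<in> Sigma0 (Suc (Suc n)) X"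
proof -
  have "(\<Union>i\<in>I. A i) = (\<Union>k. A (from_nat_into I k))"
    using range_from_nat_into[OF assms(2,1)] by (metis image_image)
  then show ?thesis
    unfolding Sigma0_Suc_Suc using assms(3) from_nat_into[OF assms(2)] by blast
qed

lemma Pi0_countable_Inter:
  assumes "countable I" "I \<noteq> {}" "\<And>i. i \<in> I \<Longrightarrow> U i \<in> Sigma0 (Suc n) X"
  shows "(\<Inter>i\<in>I. U i) \<in> Pi0 (Suc (Suc n)) X"
proof -
  have "U i \<subseteq> topspace X" if "i \<in> I" for i using assms(3)[OF that] by (rule Sigma0_subset)
  then have sub: "(\<Inter>i\<in>I. U i) \<subseteq> topspace X" using assms(2) by blast
  have "(\<Union>i\<in>I. topspace X - U i) \<in> Sigma0 (Suc (Suc n)) X"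
    using assms Sigma0_iff by (intro Sigma0_countable_Union) blast+
  moreover have "topspace X - (\<Inter>i\<in>I. U i) = (\<Union>i\<in>I. topspace X - U i)" by blast
  ultimately show ?thesis using sub by (simp only: Pi0_iff)
qed

lemma Pi0_1: "S \<in> Pi0 1 X \<longleftrightarrow> closedin X S"
  by (simp add: Pi0_iff closedin_def)

section \<open>Hardness under complements and continuous reductions\<close>

lemma hard_complement:
  assumes "hard TYPE('z) (Pic n) X A"
  shows "hard TYPE('z) (Sig n) X (topspace X - A)"
  unfolding hard_def
proof (intro allI impI)
  fix Z :: "'z topology" and B
  assume Z: "Polish_space Z \<and> Z dim_le 0 \<and> B \<in> bsets (Sig n) Z"
  then have sub: "B \<subseteq> topspace Z" and "topspace Z - B \<in> bsets (Pic n) Z"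
    using Sigma0_iff by fastforce+
  then obtain f where f: "continuous_map Z X f" "topspace Z - B = {x \<in> topspace Z. f x \<in> A}"
    using assms Z unfolding hard_def by blast
  \<comment> \<open>The same map reduces the complement, as its values never leave the space in
    which the complement is taken.\<close>
  have "f x \<in> topspace X" if "x \<in> topspace Z" for x
    using f(1) that by (auto simp: continuous_map_def)
  then have "B = {x \<in> topspace Z. f x \<in> topspace X - A}"
    using f(2) sub by blast
  then show "\<exists>f. continuous_map Z X f \<and> B = {x \<in> topspace Z. f x \<in> topspace X - A}"
    using f(1) by blast
qed

lemma bcomplete_complement:
  assumes "bcomplete TYPE('z) (Pic n) X A"
  shows "bcomplete TYPE('z) (Sig n) X (topspace X - A)"
  using assms hard_complement[where 'z='z, of n X A] unfolding bcomplete_def by (simp add: Pi0_iff)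

lemma hard_reduction:
  assumes "hard TYPE('z) G X A" "continuous_map X Y g" "\<And>x. x \<in> topspace X \<Longrightarrow> g x \<in> B \<longleftrightarrow> x \<in> A"
  shows "hard TYPE('z) G Y B"
  unfolding hard_def
proof (intro allI impI)
  fix Z :: "'z topology" and C
  assume "Polish_space Z \<and> Z dim_le 0 \<and> C \<in> bsets G Z"
  then obtain f where f: "continuous_map Z X f" "C = {x \<in> topspace Z. f x \<in> A}"
    using assms(1) unfolding hard_def by blast
  have "f x \<in> topspace X" if "x \<in> topspace Z" for x
    using f(1) that by (auto simp: continuous_map_def)
  then have "C = {x \<in> topspace Z. (g \<circ> f) x \<in> B}"
    using f(2) assms(3) by auto
  then show "\<exists>f. continuous_map Z Y f \<and> C = {x \<in> topspace Z. f x \<in> B}"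
    using continuous_map_compose[OF f(1) assms(2)] by blast
qed

section \<open>Clopen sets in zero-dimensional Polish spaces\<close>

definition clopenin :: "'a topology \<Rightarrow> 'a set \<Rightarrow> bool" where
  "clopenin X S \<longleftrightarrow> openin X S \<and> closedin X S"

text \<open>Dimension zero gives a clopen base and separability makes the union countable: for each
  ball with centre in a countable dense set and radius 1/(n+1), at most one clopen set between the
  ball and \<open>U\<close> is selected.\<close>

lemma open_eq_Union_clopen:
  assumes "Polish_space Z" "Z dim_le 0" "openin Z U"
  obtains C :: "nat \<Rightarrow> 'a set" where "\<And>k. clopenin Z (C k)" "U = (\<Union>k. C k)"
proof -
  obtain M d where M: "Metric_space M d" and Z: "Z = Metric_space.mtopology M d"
    using assms(1) completely_metrizable_imp_metrizable_space
    unfolding Polish_space_def metrizable_space_def by blast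
  interpret Metric_space M d by (rule M)
  obtain D where D: "countable D" "D \<subseteq> M" "Z closure_of D = M"
    using assms(1) Z unfolding Polish_space_def separable_space_def by auto
  have "neighbourhood_base_of (clopenin Z) Z"
    using assms(2) unfolding dimension_le_0_neighbourhood_base_of_clopen clopenin_def
    by (simp add: conj_commute)
  then have base: "\<exists>C. clopenin Z C \<and> x \<in> C \<and> C \<subseteq> W" if "openin Z W" "x \<in> W" for W x
    using open_neighbourhood_base_of[of "clopenin Z" Z] that unfolding clopenin_def by auto
  define ok where "ok = (\<lambda>(a, n::nat) C. clopenin Z C \<and> C \<subseteq> U \<and> mball a (inverse (Suc n)) \<subseteq> C)"
  \<comment> \<open>\<open>None\<close> indexes the empty set, so \<open>I\<close> is nonempty even
    if no ball qualifies.\<close>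
  define I where "I = insert None (Some ` {p \<in> D \<times> UNIV. \<exists>C. ok p C})"
  define E where "E = case_option {} (\<lambda>p. SOME C. ok p C)"
  have E: "ok p (E (Some p))" if "\<exists>C. ok p C" for p
    using that unfolding E_def by (simp add: someI_ex)
  have clopen: "clopenin Z (E i) \<and> E i \<subseteq> U" if "i \<in> I" for i
  proof (cases i)
    case None
    then show ?thesis by (simp add: E_def clopenin_def)
  next
    case (Some p)
    then have "ok p (E i)" using E[of p] that by (auto simp: I_def)
    then show ?thesis by (cases p) (simp add: ok_def)
  qed
  have "U \<subseteq> (\<Union>i\<in>I. E i)"
  proof
    fix x assume "x \<in> U"
    then obtain C where C: "clopenin Z C" "x \<in> C" "C \<subseteq> U"
      using base assms(3) by blast
    then have "openin mtopology C" using Z unfolding clopenin_def by simp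
    moreover from this have xM: "x \<in> M" using C(2) openin_subset[of mtopology C] by auto
    ultimately obtain e where e: "e > 0" "mball x e \<subseteq> C"
      using C(2) unfolding openin_mtopology by blast
    \<comment> \<open>With the radius below \<open>e / 2\<close>, a centre \<open>a\<close> within
      that radius of \<open>x\<close> has its ball inside \<open>mball x e\<close>, and the ball
      still contains \<open>x\<close>.\<close>
    then obtain n where n: "inverse (real (Suc n)) < e / 2"
      using reals_Archimedean[of "e / 2"] by auto
    have "x \<in> mtopology closure_of D" using D(3) xM Z by simp
    moreover have "0 < inverse (real (Suc n))" by simp
    ultimately obtain a where a: "a \<in> D" "a \<in> mball x (inverse (Suc n))"
      unfolding metric_closure_of by blast
    have ax: "d a x < inverse (real (Suc n))" "a \<in> M" using a(2) commute by auto
    then have "mball a (inverse (Suc n)) \<subseteq> mball x e"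
      using n xM by (intro mball_subset) linarith
    then have "ok (a, n) C" using C e by (simp add: ok_def)
    then have "\<exists>C. ok (a, n) C" by blast
    then have "Some (a, n) \<in> I" "mball a (inverse (Suc n)) \<subseteq> E (Some (a, n))"
      using a(1) E[of "(a, n)"] by (auto simp: I_def ok_def)
    moreover have "x \<in> mball a (inverse (Suc n))" using ax xM by simp
    ultimately show "x \<in> (\<Union>i\<in>I. E i)" by blast
  qed
  then have "U = (\<Union>i\<in>I. E i)" using clopen by blast
  moreover have "I \<noteq> {}" "countable I" using D(1) by (auto simp: I_def)
  ultimately have "U = (\<Union>k. E (from_nat_into I k))"
    using range_from_nat_into[of I] by (metis image_image)
  moreover have "clopenin Z (E (from_nat_into I k))" for k
    using clopen from_nat_into[OF \<open>I \<noteq> {}\<close>] by blast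
  ultimately show ?thesis by (intro that[of "\<lambda>k. E (from_nat_into I k)"]) simp_all
qed

section \<open>Clopen approximations and continuity of set-valued maps\<close>

lemma clopenin_Un: "clopenin X S \<Longrightarrow> clopenin X T \<Longrightarrow> clopenin X (S \<union> T)"
  by (simp add: clopenin_def openin_Un closedin_Un)

lemma clopenin_Diff: "clopenin X S \<Longrightarrow> clopenin X T \<Longrightarrow> clopenin X (S - T)"
  by (simp add: clopenin_def openin_diff closedin_diff)

lemma clopenin_Union:
  assumes "finite I" "\<And>i. i \<in> I \<Longrightarrow> clopenin X (S i)"
  shows "clopenin X (\<Union>i\<in>I. S i)"
  using assms
proof (induction rule: finite_induct)
  case empty
  then show ?case by (simp add: clopenin_def)
next
  case (insert i I)
  then show ?case by (simp add: clopenin_Un)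
qed

lemma clopenin_Inter:
  assumes "finite I" "I \<noteq> {}" "\<And>i. i \<in> I \<Longrightarrow> clopenin X (S i)"
  shows "clopenin X (\<Inter>i\<in>I. S i)"
  using assms unfolding clopenin_def by (intro conjI openin_INT2 closedin_INT) auto

text \<open>\<open>P\<close> enumerates the events ``\<open>k\<close> is the first stage at which \<open>x\<close> is seen to belong to
  the first \<open>m + 1\<close> open sets''; for each \<open>m\<close> there is at most one such \<open>k\<close>.\<close>
lemma Pi0_2_infinitely_often:
  assumes "Polish_space Z" "Z dim_le 0" "B \<in> Pi0 2 Z"
  obtains P :: "nat \<Rightarrow> 'a set"
  where "\<And>k. clopenin Z (P k)" "B = {x \<in> topspace Z. infinite {k. x \<in> P k}}"
proof -
  obtain U where U: "B = topspace Z \<inter> (\<Inter>i::nat. U i)" "\<And>i. openin Z (U i)"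
    using assms(3) Pi0_Suc_Suc[of B 0 Z] by (auto simp: numeral_2_eq_2)
  have "\<exists>C::nat \<Rightarrow> 'a set. (\<forall>k. clopenin Z (C k)) \<and> U i = (\<Union>k. C k)" for i
    using open_eq_Union_clopen[OF assms(1,2) U(2)[of i]] by metis
  then obtain C :: "nat \<Rightarrow> nat \<Rightarrow> 'a set"
    where C: "\<And>i k. clopenin Z (C i k)" "\<And>i. U i = (\<Union>k. C i k)" by metis
  define V where "V m k = (\<Inter>i\<in>{..m}. \<Union>j\<in>{..k}. C i j)" for m k
  define W where "W m k = V m k - (\<Union>j\<in>{..<k}. V m j)" for m k
  define P where "P n = (case prod_decode n of (m, k) \<Rightarrow> W m k)" for n
  have "clopenin Z (V m k)" for m k
    unfolding V_def by (intro clopenin_Inter clopenin_Union C(1)) auto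
  then have "clopenin Z (W m k)" for m k
    unfolding W_def by (intro clopenin_Diff clopenin_Union) auto
  then have "clopenin Z (P n)" for n
    unfolding P_def by (simp split: prod.split)
  moreover have "B = {x \<in> topspace Z. infinite {n. x \<in> P n}}"
  proof (rule set_eqI, rule iffI)
    fix x assume x: "x \<in> B"
    have "\<exists>k. x \<in> W m k" for m
    proof -
      have "\<forall>i. \<exists>j. x \<in> C i j" using x U(1) C(2) by blast
      then obtain j where j: "\<And>i. x \<in> C i (j i)" by metis
      \<comment> \<open>The maximum is a common stage by which \<open>x\<close> has entered all of
        the first m + 1 open sets; the least such stage gives membership in
        \<open>W\<close>.\<close>
      have "j i \<le> Max (j ` {..m})" if "i \<le> m" for i using that by simp
      then have "x \<in> V m (Max (j ` {..m}))" unfolding V_def using j by blast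
      then have "\<exists>k. x \<in> V m k \<and> (\<forall>l<k. x \<notin> V m l)"
        using exists_least_iff[of "\<lambda>k. x \<in> V m k"] by blast
      then show ?thesis unfolding W_def by auto
    qed
    then obtain k where "\<And>m. x \<in> W m (k m)" by metis
    then have "(\<lambda>m. prod_encode (m, k m)) ` UNIV \<subseteq> {n. x \<in> P n}" by (auto simp: P_def)
    moreover have "inj (\<lambda>m. prod_encode (m, k m))"
      by (rule injI) simp
    ultimately have "infinite {n. x \<in> P n}"
      by (metis finite_imageD finite_subset infinite_UNIV_nat)
    then show "x \<in> {x \<in> topspace Z. infinite {n. x \<in> P n}}" using x U(1) by blast
  next
    fix x assume "x \<in> {x \<in> topspace Z. infinite {n. x \<in> P n}}"
    then have x: "x \<in> topspace Z" and inf: "infinite {n. x \<in> P n}" by auto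
    have uniq: "k = k'" if "x \<in> W m k" "x \<in> W m k'" for m k k'
      using that unfolding W_def by (metis DiffE UN_I lessThan_iff linorder_neqE_nat)
    \<comment> \<open>For each \<open>m\<close> at most one stage qualifies. Infinitely many hits
      therefore have unbounded first components, and \<open>x\<close> lies in every
      \<open>U i\<close>.\<close>
    have inj: "inj_on (\<lambda>n. fst (prod_decode n)) {n. x \<in> P n}"
    proof (rule inj_onI)
      fix a b assume ab: "a \<in> {n. x \<in> P n}" "b \<in> {n. x \<in> P n}" "fst (prod_decode a) = fst (prod_decode b)"
      obtain m k k' where "prod_decode a = (m, k)" "prod_decode b = (m, k')"
        using ab(3) by (metis prod.collapse)
      moreover from this have "k = k'" using ab(1,2) uniq by (simp add: P_def)
      ultimately show "a = b" by (metis prod_decode_inverse)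
    qed
    have "x \<in> U i" for i
    proof -
      have "infinite ((\<lambda>n. fst (prod_decode n)) ` {n. x \<in> P n})"
        using inf inj finite_imageD by blast
      then obtain n where n: "x \<in> P n" "i \<le> fst (prod_decode n)"
        by (auto simp: infinite_nat_iff_unbounded_le)
      obtain m k where "prod_decode n = (m, k)" by fastforce
      then have "x \<in> V m k" "i \<le> m" using n by (auto simp: P_def W_def)
      then show ?thesis unfolding V_def using C(2) by blast
    qed
    then show "x \<in> B" using x U(1) by blast
  qed
  ultimately show ?thesis by (rule that)
qed

text \<open>The complement of each \<open>\<Sigma>\<^sup>0\<^sub>2\<close> set in the intersection
  is described by infinitely many hits, so the set itself is described by finitely many.\<close>

lemma Pi0_3_finitely_often:
  assumes "Polish_space Z" "Z dim_le 0" "B \<in> Pi0 3 Z"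
  obtains P :: "nat \<Rightarrow> nat \<Rightarrow> 'a set"
  where "\<And>n k. clopenin Z (P n k)" "B = {x \<in> topspace Z. \<forall>n. finite {k. x \<in> P n k}}"
proof -
  obtain U where U: "B = topspace Z \<inter> (\<Inter>i::nat. U i)" "\<And>i. U i \<in> Sigma0 2 Z"
    using assms(3) Pi0_Suc_Suc[of B 1 Z] by (auto simp: numeral_2_eq_2 numeral_3_eq_3)
  have "\<forall>i. \<exists>P::nat \<Rightarrow> 'a set. (\<forall>k. clopenin Z (P k)) \<and>
      topspace Z - U i = {x \<in> topspace Z. infinite {k. x \<in> P k}}"
  proof
    fix i
    have "topspace Z - U i \<in> Pi0 2 Z" using U(2) Sigma0_iff by blast
    then obtain P :: "nat \<Rightarrow> 'a set" where "\<And>k. clopenin Z (P k)"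
        "topspace Z - U i = {x \<in> topspace Z. infinite {k. x \<in> P k}}"
      using Pi0_2_infinitely_often[OF assms(1,2)] by blast
    then show "\<exists>P::nat \<Rightarrow> 'a set. (\<forall>k. clopenin Z (P k)) \<and>
        topspace Z - U i = {x \<in> topspace Z. infinite {k. x \<in> P k}}"
      by (intro exI[of _ P]) simp
  qed
  from choice[OF this] obtain P :: "nat \<Rightarrow> nat \<Rightarrow> 'a set" where P: "\<And>i k. clopenin Z (P i k)"
      "\<And>i. topspace Z - U i = {x \<in> topspace Z. infinite {k. x \<in> P i k}}" by blast
  have "x \<in> U i \<longleftrightarrow> finite {k. x \<in> P i k}" if "x \<in> topspace Z" for x i
    using P(2)[of i] that by blast
  then have "B = {x \<in> topspace Z. \<forall>n. finite {k. x \<in> P n k}}" using U(1) by blast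
  with P(1) show ?thesis by (rule that)
qed

section \<open>Local constancy of thickenings\<close>

definition thick_loc_const :: "'a topology \<Rightarrow> ('a \<Rightarrow> (nat \<Rightarrow> bool) set) \<Rightarrow> bool" where
  "thick_loc_const Z f \<longleftrightarrow> (\<forall>x\<in>topspace Z. \<forall>n.
     \<exists>U. openin Z U \<and> x \<in> U \<and> (\<forall>x'\<in>U. thick n (f x') = thick n (f x)))"

text \<open>The continuity criterion with local constancy as a separate predicate, so that it can be
  checked block by block and carried through \<open>glue\<close> independently of
  compactness.\<close>

lemma thick_loc_const_continuous:
  assumes "thick_loc_const Z f" "\<And>x. x \<in> topspace Z \<Longrightarrow> f x \<in> Kset"
  shows "continuous_map Z vietoris f"
  using assms unfolding thick_loc_const_def by (intro continuous_map_vietorisI) auto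

text \<open>Only finitely many clopen sets are involved, so those containing \<open>x\<close> and
  the complements of the others have an open intersection.\<close>

lemma clopen_agree_nbhd:
  assumes "\<And>k. clopenin Z (P k)" "x \<in> topspace Z"
  obtains U where "openin Z U" "x \<in> U" "\<And>x' k. x' \<in> U \<Longrightarrow> k < n \<Longrightarrow> x' \<in> P k \<longleftrightarrow> x \<in> P (k::nat)"
proof -
  let ?V = "\<lambda>k. if x \<in> P k then P k else topspace Z - P k"
  have "openin Z (?V k)" for k using assms(1)[of k] by (auto simp: clopenin_def)
  then have "openin Z ((\<Inter>k\<in>{..<n}. ?V k) \<inter> topspace Z)" by (intro openin_INT) auto
  then show ?thesis
    by (rule that) (use assms(2) in \<open>auto split: if_splits\<close>)
qed

lemma thick_loc_const_if:
  assumes "clopenin Z P"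
  shows "thick_loc_const Z (\<lambda>x. if x \<in> P then A else B)"
  unfolding thick_loc_const_def
proof (intro ballI allI)
  fix x n assume "x \<in> topspace Z"
  then obtain U where U: "openin Z U" "x \<in> U"
      "\<And>x' k. x' \<in> U \<Longrightarrow> k < Suc 0 \<Longrightarrow> x' \<in> P \<longleftrightarrow> x \<in> P"
    using clopen_agree_nbhd[of Z "\<lambda>_. P" x "Suc 0"] assms by metis
  have "(if x' \<in> P then A else B) = (if x \<in> P then A else B)" if "x' \<in> U" for x'
    using U(3)[OF that] by (cases "x \<in> P") simp_all
  then show "\<exists>U. openin Z U \<and> x \<in> U \<and> (\<forall>x'\<in>U.
      thick n (if x' \<in> P then A else B) = thick n (if x \<in> P then A else B))"
    using U(1,2) by (intro exI[of _ U] conjI ballI arg_cong[of _ _ "thick n"])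
qed

lemma thick_loc_const_const: "thick_loc_const Z (\<lambda>_. A)"
  unfolding thick_loc_const_def using openin_topspace by blast

lemma thick_zeros_on: "thick n (zeros_on S) = zeros_on (S \<inter> {..<n})"
proof (intro equalityI subsetI)
  fix y assume "y \<in> zeros_on (S \<inter> {..<n})"
  \<comment> \<open>Cutting \<open>y\<close> off at \<open>n\<close> keeps its first
    \<open>n\<close> digits and satisfies all constraints from \<open>n\<close> on.\<close>
  then have "(\<lambda>i. i < n \<and> y i) \<in> zeros_on S" by (auto simp: zeros_on_def)
  then show "y \<in> thick n (zeros_on S)" unfolding mem_thick by (rule bexI[rotated]) simp
qed (auto simp: mem_thick zeros_on_def)

lemma thick_loc_const_zeros_on:
  assumes "\<And>k. clopenin Z (P k)"
  shows "thick_loc_const Z (\<lambda>x. zeros_on {k. x \<in> P k})"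
  unfolding thick_loc_const_def
proof (intro ballI allI)
  fix x n assume "x \<in> topspace Z"
  then obtain U where U: "openin Z U" "x \<in> U" "\<And>x' k. x' \<in> U \<Longrightarrow> k < n \<Longrightarrow> x' \<in> P k \<longleftrightarrow> x \<in> P k"
    using clopen_agree_nbhd[of Z P x n] assms by metis
  have "{k. x' \<in> P k} \<inter> {..<n} = {k. x \<in> P k} \<inter> {..<n}" if "x' \<in> U" for x'
    using U(3)[OF that] by blast
  then have "\<forall>x'\<in>U. thick n (zeros_on {k. x' \<in> P k}) = thick n (zeros_on {k. x \<in> P k})"
    unfolding thick_zeros_on by metis
  then show "\<exists>U. openin Z U \<and> x \<in> U \<and>
      (\<forall>x'\<in>U. thick n (zeros_on {k. x' \<in> P k}) = thick n (zeros_on {k. x \<in> P k}))"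
    using U(1,2) by blast
qed

text \<open>Reaching block \<open>k\<close> consumes k + 1 digits, which leaves level
  \<open>n - Suc k\<close> for that block, and blocks from \<open>n\<close> on are invisible. For
  the last visible block level 0 remains, which still tells an empty block from a nonempty
  one.\<close>

lemma thick_glue: "thick n (glue K) = glue (\<lambda>k. if k < n then thick (n - Suc k) (K k) else UNIV)"
proof (intro equalityI subsetI)
  fix y assume "y \<in> thick n (glue K)"
  then obtain x where x: "x \<in> glue K" "\<forall>i<n. y i = x i" by (auto simp: mem_thick)
  have "(\<lambda>i. y (Suc k + i)) \<in> thick (n - Suc k) (K k)" if "k < n" "y k" "\<forall>i<k. \<not> y i" for k
  proof -
    have "x k \<and> (\<forall>i<k. \<not> x i)" using x(2) that by simp
    then have "(\<lambda>i. x (Suc k + i)) \<in> K k" using x(1) by (simp add: glue_def)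
    then show ?thesis unfolding mem_thick using x(2) by (intro bexI[of _ "\<lambda>i. x (Suc k + i)"]) auto
  qed
  then show "y \<in> glue (\<lambda>k. if k < n then thick (n - Suc k) (K k) else UNIV)"
    by (auto simp: glue_def)
next
  fix y assume y: "y \<in> glue (\<lambda>k. if k < n then thick (n - Suc k) (K k) else UNIV)"
  show "y \<in> thick n (glue K)"
  proof (cases "\<exists>k<n. y k")
    case True
    then obtain k where k: "k < n" "y k" "\<forall>i<k. \<not> y i"
      using exists_least_iff[of "\<lambda>k. k < n \<and> y k"] by (metis less_trans)
    then have "(\<lambda>i. y (Suc k + i)) \<in> thick (n - Suc k) (K k)" using y by (auto simp: glue_def)
    then obtain x where x: "x \<in> K k" "\<And>i. i < n - Suc k \<Longrightarrow> y (Suc k + i) = x i"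
      by (auto simp: mem_thick)
    \<comment> \<open>\<open>y\<close> is kept up to its first 1 at place \<open>k\<close> and its
      tail is exchanged for \<open>x\<close>; the first 1 stays at \<open>k\<close>, so only block
      \<open>k\<close> is tested.\<close>
    define w where "w i = (if i \<le> k then y i else x (i - Suc k))" for i
    have first: "l = k" if "w l" "\<forall>i<l. \<not> w i" for l
    proof (rule ccontr)
      assume "l \<noteq> k"
      then consider "l < k" | "k < l" by linarith
      then show False
      proof cases
        case 1
        then show False using that(1) k(3) by (simp add: w_def)
      next
        case 2
        then show False using that(2) k(2) by (auto simp: w_def)
      qed
    qed
    have "(\<lambda>i. w (Suc k + i)) = x" by (auto simp: w_def)
    then have "w \<in> glue K" unfolding glue_def using x(1) first by auto
    moreover have "y i = w i" if "i < n" for i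
      using x(2)[of "i - Suc k"] that by (auto simp: w_def)
    ultimately show ?thesis unfolding mem_thick by blast
  next
    case False
    \<comment> \<open>The zero sequence meets no block and lies in every \<open>glue K\<close>; it
      witnesses the case where the first \<open>n\<close> digits vanish.\<close>
    moreover have "zero_seq \<in> glue K" by (simp add: glue_def)
    ultimately show ?thesis unfolding mem_thick by (intro bexI[of _ zero_seq]) auto
  qed
qed

lemma thick_loc_const_glue:
  assumes "\<And>k. thick_loc_const Z (\<lambda>x. K x k)"
  shows "thick_loc_const Z (\<lambda>x. glue (K x))"
  unfolding thick_loc_const_def
proof (intro ballI allI)
  fix x n assume x: "x \<in> topspace Z"
  have "\<exists>U. openin Z U \<and> x \<in> U \<and> (\<forall>x'\<in>U. thick (n - Suc k) (K x' k) = thick (n - Suc k) (K x k))" for k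
    using assms[of k] x unfolding thick_loc_const_def by blast
  then obtain U where U: "\<And>k. openin Z (U k)" "\<And>k. x \<in> U k"
      "\<And>k x'. x' \<in> U k \<Longrightarrow> thick (n - Suc k) (K x' k) = thick (n - Suc k) (K x k)" by metis
  let ?V = "(\<Inter>k\<in>{..<n}. U k) \<inter> topspace Z"
  have "openin Z ?V" using U(1) by (intro openin_INT) auto
  moreover have "x \<in> ?V" using U(2) x by blast
  moreover have "thick n (glue (K x')) = thick n (glue (K x))" if x': "x' \<in> ?V" for x'
  proof -
    have "(if k < n then thick (n - Suc k) (K x' k) else UNIV) = (if k < n then thick (n - Suc k) (K x k) else UNIV)" for k
      using U(3)[of x' k] x' by (cases "k < n") auto
    then show ?thesis unfolding thick_glue by presburger
  qed
  ultimately show "\<exists>U. openin Z U \<and> x \<in> U \<and> (\<forall>x'\<in>U. thick n (glue (K x')) = thick n (glue (K x)))"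
    by blast
qed

lemma UNIV_Kset: "UNIV \<in> Kset"
  by (simp add: Kset_iff)

lemma empty_Kset: "{} \<in> Kset"
  by (simp add: Kset_iff)

section \<open>Hardness\<close>

lemma binary_expansion:
  fixes r :: real
  assumes "0 \<le> r" "r \<le> 1"
  obtains b :: "nat \<Rightarrow> bool" where "(\<lambda>k. of_bool (b k) / 2 ^ Suc k) sums r"
proof -
  \<comment> \<open>\<open>s n\<close> is the remainder after \<open>n\<close> digits, scaled by
    2^n; the next digit is 1 exactly if it is at least 1/2. For \<open>r = 1\<close> all digits are
    1.\<close>
  define s :: "nat \<Rightarrow> real" where "s = rec_nat r (\<lambda>_ t. 2 * t - of_bool (1/2 \<le> t))"
  have s_0: "s 0 = r" by (simp add: s_def)
  have s_Suc: "s (Suc n) = 2 * s n - of_bool (1/2 \<le> s n)" for n by (simp add: s_def)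
  have s: "0 \<le> s n \<and> s n \<le> 1" for n
    by (induction n) (use assms in \<open>auto simp: s_Suc s_0 of_bool_def\<close>)
  define b where "b n \<longleftrightarrow> 1/2 \<le> s n" for n
  have eq: "r = (\<Sum>k<n. of_bool (b k) / 2 ^ Suc k) + s n / 2 ^ n" for n
  proof (induction n)
    case 0
    then show ?case by (simp add: s_def)
  next
    case (Suc n)
    have "s n / 2 ^ n = of_bool (b n) / 2 ^ Suc n + s (Suc n) / 2 ^ Suc n"
      by (simp add: s_Suc b_def field_simps)
    then show ?case using Suc by simp
  qed
  have "(\<lambda>n. s n / 2 ^ n) \<longlonglongrightarrow> 0"
  proof (rule tendsto_sandwich)
    show "\<forall>\<^sub>F n in sequentially. 0 \<le> s n / 2 ^ n" using s by simp
    show "\<forall>\<^sub>F n in sequentially. s n / 2 ^ n \<le> (1/2) ^ n"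
      using s by (intro always_eventually allI) (simp add: power_one_over divide_right_mono)
    show "(\<lambda>n. (1/2::real) ^ n) \<longlonglongrightarrow> 0" by (simp add: LIMSEQ_power_zero)
  qed simp
  then have "(\<lambda>n. r - s n / 2 ^ n) \<longlonglongrightarrow> r - 0" by (intro tendsto_intros)
  moreover have "r - s n / 2 ^ n = (\<Sum>k<n. of_bool (b k) / 2 ^ Suc k)" for n
    using eq[of n] by linarith
  ultimately have "(\<lambda>k. of_bool (b k) / 2 ^ Suc k) sums r" unfolding sums_def by simp
  then show ?thesis by (rule that)
qed

lemma half_powers_sums: "(\<lambda>k. c / 2 ^ Suc k) sums (c::real)"
  using sums_mult[OF power_half_series, of c] by (simp add: power_one_over)

text \<open>The blocks at the digits 1 of \<open>r\<close> are full and contribute exactly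
  \<open>r\<close>. A block at a digit 0 receives a set that is null iff \<open>x\<close> lies in
  \<open>B\<close>, so the total exceeds \<open>r\<close> iff this set is not null.\<close>

lemma hard_measure_le:
  assumes "0 \<le> r" "r < 1"
  shows "hard TYPE('z) (Pic 2) vietoris {K \<in> Kset. measure coin K \<le> r}"
  unfolding hard_def
proof (intro allI impI)
  fix Z :: "'z topology" and B
  assume Z: "Polish_space Z \<and> Z dim_le 0 \<and> B \<in> bsets (Pic 2) Z"
  then obtain P :: "nat \<Rightarrow> 'z set" where P: "\<And>k. clopenin Z (P k)"
      "B = {x \<in> topspace Z. infinite {k. x \<in> P k}}"
    using Pi0_2_infinitely_often[of Z B] by auto
  obtain b where b: "(\<lambda>k. of_bool (b k) / 2 ^ Suc k) sums r"
    using binary_expansion assms by (metis less_imp_le)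
  \<comment> \<open>\<open>r < 1\<close> rules out the expansion with all digits 1, so some block is
    free.\<close>
  have "\<exists>k. \<not> b k"
  proof (rule ccontr)
    assume "\<not> (\<exists>k. \<not> b k)"
    then have "(\<lambda>k. of_bool (b k) / 2 ^ Suc k) = (\<lambda>k. 1 / 2 ^ Suc k :: real)" by simp
    then have "r = 1" using b half_powers_sums[of 1] sums_unique2 by metis
    then show False using assms by simp
  qed
  then obtain k0 where k0: "\<not> b k0" by blast
  define Y where "Y x = zeros_on {k. x \<in> P k}" for x
  define J where "J x k = (if k = k0 then Y x else if b k then UNIV else {})" for x k
  have J: "J x k \<in> Kset" for x k
    by (simp add: J_def Y_def zeros_on_Kset UNIV_Kset empty_Kset)
  have "thick_loc_const Z (\<lambda>x. J x k)" for k
    using thick_loc_const_zeros_on[of Z P, OF P(1)] thick_loc_const_const[of Z]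
    by (cases "k = k0"; cases "b k") (simp_all add: J_def Y_def)
  then have "continuous_map Z vietoris (\<lambda>x. glue (J x))"
    by (intro thick_loc_const_continuous thick_loc_const_glue glue_Kset J)
  moreover have "measure coin (glue (J x)) \<le> r \<longleftrightarrow> infinite {k. x \<in> P k}" for x
  proof -
    have "(\<lambda>k. of_bool (b k) / 2 ^ Suc k + (if k = k0 then measure coin (Y x) / 2 ^ Suc k else 0))
        sums (r + measure coin (Y x) / 2 ^ Suc k0)"
      by (rule sums_add[OF b sums_single])
    moreover have "of_bool (b k) / 2 ^ Suc k + (if k = k0 then measure coin (Y x) / 2 ^ Suc k else 0)
        = measure coin (J x k) / 2 ^ Suc k" for k
      using k0 by (auto simp: J_def)
    ultimately have "(\<lambda>k. measure coin (J x k) / 2 ^ Suc k) sums (r + measure coin (Y x) / 2 ^ Suc k0)"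
      by (simp only:)
    then have "measure coin (glue (J x)) = r + measure coin (Y x) / 2 ^ Suc k0"
      by (rule sums_unique2[OF measure_glue_sums[OF J]])
    then have "measure coin (glue (J x)) \<le> r \<longleftrightarrow> measure coin (Y x) / 2 ^ Suc k0 \<le> 0"
      by linarith
    also have "\<dots> \<longleftrightarrow> measure coin (Y x) \<le> 0"
    proof -
      have "0 < (2::real) ^ Suc k0" by (rule zero_less_power) simp
      from pos_divide_le_eq[OF this, of "measure coin (Y x)" 0] show ?thesis
        unfolding mult_zero_left .
    qed
    finally show ?thesis unfolding Y_def measure_zeros_on_le .
  qed
  then have "B = {x \<in> topspace Z. glue (J x) \<in> {K \<in> Kset. measure coin K \<le> r}}"
    using P(2) glue_Kset J by blast
  ultimately show "\<exists>f. continuous_map Z vietoris f \<and>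
      B = {x \<in> topspace Z. f x \<in> {K \<in> Kset. measure coin K \<le> r}}" by blast
qed

section \<open>Transfer of hardness to the parameter spaces\<close>

lemma topspace_unit_top [simp]: "topspace unit_top = {0..1}"
  by (simp add: unit_top_def)

lemma topspace_spaceA: "topspace spaceA = Kset \<times> UNIV \<times> UNIV \<times> {0..1}"
  by (simp add: spaceA_def omega_top_def)

lemma topspace_spaceB: "topspace spaceB = Kset \<times> UNIV \<times> {0..1}"
  by (simp add: spaceB_def)

lemma continuous_map_into_spaceA:
  assumes "continuous_map Z vietoris f" "r \<in> {0..1}"
  shows "continuous_map Z spaceA (\<lambda>x. (f x, z, n, r))"
  unfolding spaceA_def
  by (intro continuous_map_pairedI assms(1)) (use assms(2) in \<open>simp_all add: omega_top_def\<close>)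

lemma continuous_map_into_spaceB:
  assumes "continuous_map Z vietoris f" "r \<in> {0..1}"
  shows "continuous_map Z spaceB (\<lambda>x. (f x, z, r))"
  unfolding spaceB_def
  by (intro continuous_map_pairedI assms(1)) (use assms(2) in simp_all)

lemma thick_loc_const_vietoris: "thick_loc_const vietoris (\<lambda>K. K)"
  unfolding thick_loc_const_def
proof (intro ballI allI)
  fix K n assume "K \<in> topspace vietoris"
  then have "openin vietoris {L \<in> Kset. thick n L = thick n K}" "K \<in> Kset"
    using openin_vietoris_thick_eq by simp_all
  then show "\<exists>U. openin vietoris U \<and> K \<in> U \<and> (\<forall>L\<in>U. thick n L = thick n K)" by blast
qed

lemma hard_A_le: "hard TYPE('z) (Pic 2) spaceA A_le"
proof (rule hard_reduction)
  show "hard TYPE('z) (Pic 2) vietoris {K \<in> Kset. measure coin K \<le> 0}"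
    by (rule hard_measure_le) simp_all
  show "continuous_map vietoris spaceA (\<lambda>K. (K, zero_seq, 0, 0))"
    by (rule continuous_map_into_spaceA) (simp_all add: continuous_map_id[unfolded id_def])
qed (simp add: A_le_def)

text \<open>At radius 0 the relations \<open>\<le>\<close> and \<open>=\<close> agree because
  measures are nonnegative, so the embedding used for \<open>A_le\<close> works again.\<close>

lemma hard_A_eq: "hard TYPE('z) (Pic 2) spaceA A_eq"
proof (rule hard_reduction)
  show "hard TYPE('z) (Pic 2) vietoris {K \<in> Kset. measure coin K \<le> 0}"
    by (rule hard_measure_le) simp_all
  show "continuous_map vietoris spaceA (\<lambda>K. (K, zero_seq, 0, 0))"
    by (rule continuous_map_into_spaceA) (simp_all add: continuous_map_id[unfolded id_def])
qed (simp add: A_eq_def measure_le_0_iff)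

text \<open>With a copy of \<open>K\<close> in every block, all tails look alike: every ratio at the
  zero sequence equals the measure of \<open>K\<close>, and so does the lower density.\<close>

lemma hard_Bm_le: "hard TYPE('z) (Pic 2) spaceB Bm_le"
proof (rule hard_reduction)
  show "hard TYPE('z) (Pic 2) vietoris {K \<in> Kset. measure coin K \<le> 0}"
    by (rule hard_measure_le) simp_all
  have "continuous_map vietoris vietoris (\<lambda>K. glue (\<lambda>_. K))"
    by (intro thick_loc_const_continuous thick_loc_const_glue thick_loc_const_vietoris glue_Kset) simp
  then show "continuous_map vietoris spaceB (\<lambda>K. (glue (\<lambda>_. K), zero_seq, 0))"
    by (rule continuous_map_into_spaceB) simp
  fix K assume "K \<in> topspace vietoris"
  then have K: "K \<in> Kset" by simp
  have "measure coin (glue (\<lambda>_. K)) = measure coin K"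
    using measure_glue_sums[of "\<lambda>_. K"] K half_powers_sums sums_unique2 by metis
  then have "dratio (glue (\<lambda>_. K)) zero_seq n = measure coin K" for n
    using dratio_glue[of "\<lambda>_. K"] K by simp
  then have "lower_density (glue (\<lambda>_. K)) zero_seq = ereal (measure coin K)"
    unfolding lower_density_def by (simp add: Liminf_const)
  moreover have "glue (\<lambda>_. K) \<in> Kset" using K by (intro glue_Kset)
  ultimately show "(glue (\<lambda>_. K), zero_seq, 0) \<in> Bm_le \<longleftrightarrow> K \<in> {K \<in> Kset. measure coin K \<le> 0}"
    using K by (simp add: Bm_le_def zero_ereal_def)
qed

section \<open>Lower limits in terms of number quantifiers\<close>

lemma le_liminf_iff_real:
  "ereal r \<le> liminf (\<lambda>n. ereal (a n)) \<longleftrightarrow> (\<forall>j. \<exists>N. \<forall>n\<ge>N. r - inverse (real (Suc j)) \<le> a n)"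
proof
  assume r: "ereal r \<le> liminf (\<lambda>n. ereal (a n))"
  show "\<forall>j. \<exists>N. \<forall>n\<ge>N. r - inverse (real (Suc j)) \<le> a n"
  proof
    fix j
    have "ereal (r - inverse (real (Suc j))) < ereal r" by simp
    then have "\<forall>\<^sub>F n in sequentially. ereal (r - inverse (real (Suc j))) < ereal (a n)"
      using r unfolding le_Liminf_iff by blast
    then show "\<exists>N. \<forall>n\<ge>N. r - inverse (real (Suc j)) \<le> a n"
      unfolding eventually_sequentially by (metis less_ereal.simps(1) less_imp_le)
  qed
next
  assume a: "\<forall>j. \<exists>N. \<forall>n\<ge>N. r - inverse (real (Suc j)) \<le> a n"
  have *: "ereal (r - inverse (real (Suc j))) \<le> liminf (\<lambda>n. ereal (a n))" for j
    using a by (intro Liminf_bounded) (simp add: eventually_sequentially)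
  show "ereal r \<le> liminf (\<lambda>n. ereal (a n))"
  proof (rule dense_le)
    fix y assume y: "y < ereal r"
    obtain q where q: "y < ereal q" "ereal q < ereal r" using ereal_dense2[OF y] by blast
    then obtain j where "inverse (real (Suc j)) < r - q"
      using reals_Archimedean[of "r - q"] by auto
    then have "ereal q \<le> ereal (r - inverse (real (Suc j)))" by simp
    then show "y \<le> liminf (\<lambda>n. ereal (a n))" using q(1) *[of j] by (meson order.trans less_imp_le)
  qed
qed

text \<open>The inner condition has the shape \<open>a n < r + c\<close>, which is open for density
  ratios. The companion \<open>le_liminf_iff_real\<close> takes this shape after negation, with
  negative \<open>c\<close>.\<close>

lemma liminf_le_iff_real:
  "liminf (\<lambda>n. ereal (a n)) \<le> ereal r \<longleftrightarrow> (\<forall>j N. \<exists>n\<ge>N. a n < r + inverse (real (Suc j)))"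
proof -
  have "ereal r < liminf (\<lambda>n. ereal (a n)) \<longleftrightarrow> (\<exists>j N. \<forall>n\<ge>N. r + inverse (real (Suc j)) \<le> a n)"
  proof
    assume "ereal r < liminf (\<lambda>n. ereal (a n))"
    then obtain q where q: "ereal r < ereal q" "ereal q < liminf (\<lambda>n. ereal (a n))"
      using ereal_dense2 by blast
    then obtain j where j: "inverse (real (Suc j)) < q - r"
      using reals_Archimedean[of "q - r"] by auto
    obtain N where N: "\<And>n. n \<ge> N \<Longrightarrow> q < a n"
      using less_LiminfD[OF q(2)] unfolding eventually_sequentially by auto
    have "\<forall>n\<ge>N. r + inverse (real (Suc j)) \<le> a n" using N j by fastforce
    then show "\<exists>j N. \<forall>n\<ge>N. r + inverse (real (Suc j)) \<le> a n" by blast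
  next
    assume "\<exists>j N. \<forall>n\<ge>N. r + inverse (real (Suc j)) \<le> a n"
    then obtain j N where "\<forall>n\<ge>N. r + inverse (real (Suc j)) \<le> a n" by blast
    then have "ereal (r + inverse (real (Suc j))) \<le> liminf (\<lambda>n. ereal (a n))"
      by (intro Liminf_bounded) (auto simp: eventually_sequentially)
    moreover have "ereal r < ereal (r + inverse (real (Suc j)))" by simp
    ultimately show "ereal r < liminf (\<lambda>n. ereal (a n))" by (rule less_le_trans[rotated])
  qed
  then show ?thesis by (meson not_le)
qed

text \<open>Block \<open>j\<close> codes a pair and is damaged iff \<open>x\<close> lies in the
  corresponding clopen set. The gap between density one and lower density below one lets a single
  map reduce to several sets.\<close>

lemma density_one_hard:
  assumes "Polish_space Z" "Z dim_le 0" "B \<in> Pi0 3 Z"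
  obtains f where "continuous_map Z vietoris f" "\<And>x. f x \<in> Kset"
    "\<And>x. x \<in> B \<Longrightarrow> dratio (f x) zero_seq \<longlonglongrightarrow> 1"
    "\<And>x. x \<in> topspace Z - B \<Longrightarrow> lower_density (f x) zero_seq < 1"
proof -
  obtain P :: "nat \<Rightarrow> nat \<Rightarrow> 'a set" where P: "\<And>n k. clopenin Z (P n k)"
      "B = {x \<in> topspace Z. \<forall>n. finite {k. x \<in> P n k}}"
    using Pi0_3_finitely_often[OF assms] by blast
  \<comment> \<open>Removing the cylinder of n + 1 ones leaves a compact set of measure 1 -
    1/2^(n+1).\<close>
  define A where "A n = - nbhd (\<lambda>_. True) (Suc n)" for n
  define J where "J x j = (if x \<in> P (fst (prod_decode j)) (snd (prod_decode j))
      then A (fst (prod_decode j)) else UNIV)" for x j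
  have "A n \<in> Kset" for n
    unfolding Kset_iff_closedin closedin_def A_def by (simp add: double_compl openin_nbhd Compl_eq_Diff_UNIV[symmetric])
  then have J: "J x j \<in> Kset" for x j by (simp add: J_def UNIV_Kset)
  have mA: "measure coin (A n) = 1 - (1/2) ^ Suc n" for n
    using coin.P.prob_compl[of "nbhd (\<lambda>_. True) (Suc n)"]
    by (simp add: A_def measure_nbhd Compl_eq_Diff_UNIV)
  have dr: "dratio (glue (J x)) zero_seq n = measure coin (glue (\<lambda>k. J x (n + k)))" for x n
    by (rule dratio_glue[OF J])
  have "continuous_map Z vietoris (\<lambda>x. glue (J x))"
    unfolding J_def
    by (intro thick_loc_const_continuous thick_loc_const_glue thick_loc_const_if P(1))
      (intro glue_Kset J[unfolded J_def])
  moreover have "dratio (glue (J x)) zero_seq \<longlonglongrightarrow> 1" if x: "x \<in> B" for x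
  proof (rule LIMSEQ_I)
    fix e :: real assume "0 < e"
    then obtain N where N: "(1/2) ^ N < e"
      using real_arch_pow_inv[of e "1/2"] by auto
    \<comment> \<open>These are the codes of the blocks damaged at an index below \<open>N\<close>.
      Beyond them a block loses at most \<open>(1/2) ^ N\<close>, and so does every tail.\<close>
    have "finite (\<Union>n<N. {prod_encode (n, k) |k. x \<in> P n k})"
      using x P(2) by simp
    then obtain M where M: "\<And>j. j \<in> (\<Union>n<N. {prod_encode (n, k) |k. x \<in> P n k}) \<Longrightarrow> j < M"
      unfolding finite_nat_iff_bounded by blast
    have large: "1 - (1/2) ^ N \<le> measure coin (J x j)" if "M \<le> j" for j
    proof (cases "x \<in> P (fst (prod_decode j)) (snd (prod_decode j))")
      case True
      have "N \<le> fst (prod_decode j)"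
      proof (rule ccontr)
        assume "\<not> N \<le> fst (prod_decode j)"
        moreover have "j = prod_encode (fst (prod_decode j), snd (prod_decode j))" by simp
        ultimately have "j < M" using M[of j] True by fastforce
        then show False using that by simp
      qed
      then have "(1/2::real) ^ Suc (fst (prod_decode j)) \<le> (1/2) ^ N"
        by (intro power_decreasing) auto
      then show ?thesis using True by (simp add: J_def mA)
    qed (simp add: J_def)
    have "norm (dratio (glue (J x)) zero_seq n - 1) < e" if n: "M \<le> n" for n
    proof -
      have "1 - (1/2) ^ N \<le> measure coin (glue (\<lambda>k. J x (n + k)))"
      proof (rule sums_le[OF _ half_powers_sums measure_glue_sums[OF J]])
        fix k
        show "(1 - (1/2) ^ N) / 2 ^ Suc k \<le> measure coin (J x (n + k)) / 2 ^ Suc k"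
          by (rule divide_right_mono[OF large]) (use n in simp_all)
      qed
      moreover have "measure coin (glue (\<lambda>k. J x (n + k))) \<le> 1" by (rule coin.P.prob_le_1)
      ultimately show ?thesis using N by (simp add: dr)
    qed
    then show "\<exists>no. \<forall>n\<ge>no. norm (dratio (glue (J x)) zero_seq n - 1) < e" by blast
  qed
  moreover have "lower_density (glue (J x)) zero_seq < 1" if x: "x \<in> topspace Z - B" for x
  proof -
    obtain m where m: "infinite {k. x \<in> P m k}" using x P(2) by blast
    \<comment> \<open>At the level coding \<open>(m, k)\<close> the damaged block fills half of the
      cylinder, so its loss of 1/2^(m+1) lowers the ratio by 1/2^(m+2), independently of
      \<open>k\<close>.\<close>
    have drop: "dratio (glue (J x)) zero_seq (prod_encode (m, k)) \<le> 1 - (1/2) ^ Suc (Suc m)"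
      if "x \<in> P m k" for k
    proof -
      let ?j = "prod_encode (m, k)"
      have "dratio (glue (J x)) zero_seq ?j
          = measure coin (J x ?j) / 2 + measure coin (glue (\<lambda>i. J x (?j + Suc i))) / 2"
        unfolding dr using measure_glue_rec[of "\<lambda>i. J x (?j + i)", OF J] by simp
      also have "\<dots> \<le> (1 - (1/2) ^ Suc m) / 2 + 1 / 2"
        using that coin.P.prob_le_1 by (intro add_mono divide_right_mono) (simp_all add: J_def mA)
      finally show ?thesis by (simp add: field_simps)
    qed
    have "liminf (\<lambda>n. ereal (dratio (glue (J x)) zero_seq n)) \<le> ereal (1 - (1/2) ^ Suc (Suc m))"
      unfolding liminf_le_iff_real
    proof (intro allI)
      fix j N :: nat
      have "inj_on (\<lambda>k. prod_encode (m, k)) {k. x \<in> P m k}" by (rule inj_onI) simp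
      then have "infinite ((\<lambda>k. prod_encode (m, k)) ` {k. x \<in> P m k})"
        using m finite_imageD by blast
      then obtain k where k: "x \<in> P m k" "N \<le> prod_encode (m, k)"
        by (auto simp: infinite_nat_iff_unbounded_le)
      have "0 < inverse (real (Suc j))" by simp
      then have "dratio (glue (J x)) zero_seq (prod_encode (m, k))
          < 1 - (1/2) ^ Suc (Suc m) + inverse (real (Suc j))"
        using drop[OF k(1)] by linarith
      then show "\<exists>n\<ge>N. dratio (glue (J x)) zero_seq n < 1 - (1/2) ^ Suc (Suc m) + inverse (real (Suc j))"
        using k(2) by blast
    qed
    also have "ereal (1 - (1/2) ^ Suc (Suc m)) < 1" by (simp add: one_ereal_def)
    finally show ?thesis unfolding lower_density_def .
  qed
  ultimately show ?thesis using that[of "\<lambda>x. glue (J x)"] glue_Kset J by blast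
qed

lemma lower_density_tendsto: "dratio K z \<longlonglongrightarrow> r \<Longrightarrow> lower_density K z = ereal r"
  unfolding lower_density_def by (intro lim_imp_Liminf) simp_all

text \<open>Any set that contains the points of density one and avoids those of lower density below
  one is covered; \<open>Bm_ge\<close> and \<open>B_eq\<close> are both of this kind.\<close>

lemma hard_density_one:
  assumes "\<And>K. K \<in> Kset \<Longrightarrow> dratio K zero_seq \<longlonglongrightarrow> 1 \<Longrightarrow> (K, zero_seq, 1) \<in> A"
    and "\<And>K. lower_density K zero_seq < 1 \<Longrightarrow> (K, zero_seq, 1) \<notin> A"
  shows "hard TYPE('z) (Pic 3) spaceB A"
  unfolding hard_def
proof (intro allI impI)
  fix Z :: "'z topology" and B
  assume Z: "Polish_space Z \<and> Z dim_le 0 \<and> B \<in> bsets (Pic 3) Z"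
  then have B: "B \<subseteq> topspace Z" by (simp add: Pi0_iff)
  obtain f where f: "continuous_map Z vietoris f" "\<And>x. f x \<in> Kset"
    "\<And>x. x \<in> B \<Longrightarrow> dratio (f x) zero_seq \<longlonglongrightarrow> 1"
    "\<And>x. x \<in> topspace Z - B \<Longrightarrow> lower_density (f x) zero_seq < 1"
    using density_one_hard[of Z B] Z by auto
  have "B = {x \<in> topspace Z. (f x, zero_seq, 1) \<in> A}"
  proof (intro equalityI subsetI)
    fix x assume "x \<in> B"
    then show "x \<in> {x \<in> topspace Z. (f x, zero_seq, 1) \<in> A}"
      using assms(1)[OF f(2) f(3)] B by auto
  next
    fix x assume "x \<in> {x \<in> topspace Z. (f x, zero_seq, 1) \<in> A}"
    then show "x \<in> B" using assms(2)[OF f(4)[of x]] by blast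
  qed
  moreover have "continuous_map Z spaceB (\<lambda>x. (f x, zero_seq, 1))"
    by (rule continuous_map_into_spaceB[OF f(1)]) simp
  ultimately show "\<exists>f. continuous_map Z spaceB f \<and> B = {x \<in> topspace Z. f x \<in> A}"
    by (intro exI[of _ "\<lambda>x. (f x, zero_seq, 1)"]) simp
qed

lemma hard_Bm_ge: "hard TYPE('z) (Pic 3) spaceB Bm_ge"
  by (rule hard_density_one) (auto simp: Bm_ge_def lower_density_tendsto one_ereal_def)

lemma hard_B_eq: "hard TYPE('z) (Pic 3) spaceB B_eq"
  by (rule hard_density_one) (auto simp: B_eq_def dest: lower_density_tendsto)

section \<open>Upper bounds\<close>

lemma continuous_map_loc_const:
  assumes "\<And>x. x \<in> topspace X \<Longrightarrow> f x \<in> topspace Y"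
    and "\<And>x. x \<in> topspace X \<Longrightarrow> \<exists>U. openin X U \<and> x \<in> U \<and> (\<forall>y\<in>U. f y = f x)"
  shows "continuous_map X Y f"
  unfolding continuous_map_def
proof (intro conjI allI impI)
  show "f \<in> topspace X \<rightarrow> topspace Y" using assms(1) by blast
  fix V assume "openin Y V"
  have "\<exists>U. openin X U \<and> x \<in> U \<and> U \<subseteq> {x \<in> topspace X. f x \<in> V}"
    if x: "x \<in> {x \<in> topspace X. f x \<in> V}" for x
  proof -
    obtain U where U: "openin X U" "x \<in> U" "\<forall>y\<in>U. f y = f x" using assms(2)[of x] x by blast
    have "U \<subseteq> {x \<in> topspace X. f x \<in> V}"
    proof
      fix y assume "y \<in> U"
      then have "y \<in> topspace X" "f y = f x" using U openin_subset[OF U(1)] by blast+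
      then show "y \<in> {x \<in> topspace X. f x \<in> V}" using x by simp
    qed
    then show ?thesis using U(1,2) by blast
  qed
  then show "openin X {x \<in> topspace X. f x \<in> V}" by (subst openin_subopen) blast
qed

lemma openin_less:
  fixes f g :: "'a \<Rightarrow> real"
  assumes "continuous_map X euclideanreal f" "continuous_map X euclideanreal g"
  shows "openin X {x \<in> topspace X. f x < g x}"
proof -
  have "continuous_map X euclideanreal (\<lambda>x. g x - f x)"
    using assms by (intro continuous_map_diff)
  then have "openin X {x \<in> topspace X. g x - f x \<in> {0<..}}"
    by (rule openin_continuous_map_preimage) simp
  then show ?thesis by simp
qed

lemma closedin_le:
  fixes f g :: "'a \<Rightarrow> real"
  assumes "continuous_map X euclideanreal f" "continuous_map X euclideanreal g"
  shows "closedin X {x \<in> topspace X. f x \<le> g x}"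
proof -
  have "continuous_map X euclideanreal (\<lambda>x. g x - f x)"
    using assms by (intro continuous_map_diff)
  then have "closedin X {x \<in> topspace X. g x - f x \<in> {0..}}"
    by (rule closedin_continuous_map_preimage) simp
  then show ?thesis by simp
qed

lemma less_iff_inverse_Suc: "x < y \<longleftrightarrow> (\<exists>j. x \<le> y - inverse (real (Suc j)))" for x y :: real
proof
  assume "x < y"
  then obtain j where "inverse (real (Suc j)) < y - x" using reals_Archimedean[of "y - x"] by auto
  then show "\<exists>j. x \<le> y - inverse (real (Suc j))" by (intro exI[of _ j]) simp
next
  assume "\<exists>j. x \<le> y - inverse (real (Suc j))"
  then obtain j where "x \<le> y - inverse (real (Suc j))" ..
  moreover have "0 < inverse (real (Suc j))" by simp
  ultimately show "x < y" by linarith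
qed

lemma le_iff_inverse_Suc: "x \<le> y \<longleftrightarrow> (\<forall>j. x < y + inverse (real (Suc j)))" for x y :: real
proof
  assume "x \<le> y"
  show "\<forall>j. x < y + inverse (real (Suc j))"
  proof
    fix j
    have "0 < inverse (real (Suc j))" by simp
    then show "x < y + inverse (real (Suc j))" using \<open>x \<le> y\<close> by linarith
  qed
next
  assume *: "\<forall>j. x < y + inverse (real (Suc j))"
  show "x \<le> y"
  proof (rule ccontr)
    assume "\<not> x \<le> y"
    then obtain j where "inverse (real (Suc j)) < x - y" using reals_Archimedean[of "x - y"] by auto
    then show False using *[rule_format, of j] by linarith
  qed
qed

text \<open>The value is determined by the thickening of \<open>K\<close>, the first
  \<open>n\<close> digits of \<open>z\<close> and the isolated point \<open>n\<close>, so it is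
  locally constant.\<close>

lemma continuous_thick_spaceA:
  "continuous_map spaceA euclideanreal (\<lambda>(K, z, n, r). measure coin (thick m K \<inter> nbhd z n))"
proof (rule continuous_map_loc_const)
  fix x assume "x \<in> topspace spaceA"
  then obtain K z n r where x: "x = (K, z, n, r)" and K: "K \<in> Kset" and r: "r \<in> {0..1}"
    by (auto simp: topspace_spaceA)
  let ?U = "{L \<in> Kset. thick m L = thick m K} \<times> nbhd z n \<times> {n} \<times> {0..1}"
  have "openin unit_top {0..1}" using openin_topspace[of unit_top] by simp
  moreover have "openin omega_top {n}" by (simp add: omega_top_def)
  ultimately have U1: "openin spaceA ?U"
    unfolding spaceA_def openin_prod_Times_iff using openin_vietoris_thick_eq[OF K] openin_nbhd by simp
  have U2: "x \<in> ?U" using x K r by simp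
  have U3: "(case y of (K, z, n, r) \<Rightarrow> measure coin (thick m K \<inter> nbhd z n)) =
      (case x of (K, z, n, r) \<Rightarrow> measure coin (thick m K \<inter> nbhd z n))" if "y \<in> ?U" for y
  proof -
    obtain L w s where "y = (L, w, n, s)" "thick m L = thick m K" "w \<in> nbhd z n" using \<open>y \<in> ?U\<close> by blast
    then show ?thesis unfolding x using nbhd_eq[of w z n] by simp
  qed
  show "\<exists>U. openin spaceA U \<and> x \<in> U \<and> (\<forall>y\<in>U.
      (case y of (K, z, n, r) \<Rightarrow> measure coin (thick m K \<inter> nbhd z n)) =
      (case x of (K, z, n, r) \<Rightarrow> measure coin (thick m K \<inter> nbhd z n)))"
    by (intro exI[of _ ?U] conjI U1 U2 ballI U3)
qed simp

lemma continuous_thick_spaceB: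
  "continuous_map spaceB euclideanreal (\<lambda>(K, z, r). measure coin (thick m K \<inter> nbhd z n))"
proof (rule continuous_map_loc_const)
  fix x assume "x \<in> topspace spaceB"
  then obtain K z r where x: "x = (K, z, r)" and K: "K \<in> Kset" and r: "r \<in> {0..1}"
    by (auto simp: topspace_spaceB)
  let ?U = "{L \<in> Kset. thick m L = thick m K} \<times> nbhd z n \<times> {0..1}"
  have "openin unit_top {0..1}" using openin_topspace[of unit_top] by simp
  then have U1: "openin spaceB ?U"
    unfolding spaceB_def openin_prod_Times_iff using openin_vietoris_thick_eq[OF K] openin_nbhd by simp
  have U2: "x \<in> ?U" using x K r by simp
  have U3: "(case y of (K, z, r) \<Rightarrow> measure coin (thick m K \<inter> nbhd z n)) =
      (case x of (K, z, r) \<Rightarrow> measure coin (thick m K \<inter> nbhd z n))" if "y \<in> ?U" for y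
  proof -
    obtain L w s where "y = (L, w, s)" "thick m L = thick m K" "w \<in> nbhd z n" using \<open>y \<in> ?U\<close> by blast
    then show ?thesis unfolding x using nbhd_eq[of w z n] by simp
  qed
  show "\<exists>U. openin spaceB U \<and> x \<in> U \<and> (\<forall>y\<in>U.
      (case y of (K, z, r) \<Rightarrow> measure coin (thick m K \<inter> nbhd z n)) =
      (case x of (K, z, r) \<Rightarrow> measure coin (thick m K \<inter> nbhd z n)))"
    by (intro exI[of _ ?U] conjI U1 U2 ballI U3)
qed simp

lemma continuous_unit_top: "continuous_map unit_top euclideanreal (\<lambda>r. r)"
  unfolding unit_top_def by (simp add: continuous_map_from_subtopology continuous_map_id[unfolded id_def])

lemma continuous_radius_spaceA: "continuous_map spaceA euclideanreal (\<lambda>(K, z, n, r). r)"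
proof -
  have "continuous_map spaceA euclideanreal ((\<lambda>r. r) \<circ> ((snd \<circ> snd) \<circ> snd))"
    unfolding spaceA_def
    by (rule continuous_map_compose[OF _ continuous_unit_top],
        rule continuous_map_compose[OF continuous_map_snd],
        rule continuous_map_compose[OF continuous_map_snd continuous_map_snd])
  then show ?thesis by (simp add: comp_def case_prod_unfold)
qed

lemma continuous_radius_spaceB: "continuous_map spaceB euclideanreal (\<lambda>(K, z, r). r)"
proof -
  have "continuous_map spaceB euclideanreal ((\<lambda>r. r) \<circ> (snd \<circ> snd))"
    unfolding spaceB_def
    by (rule continuous_map_compose[OF _ continuous_unit_top],
        rule continuous_map_compose[OF continuous_map_snd continuous_map_snd])
  then show ?thesis by (simp add: comp_def case_prod_unfold)
qed

text \<open>The condition holds iff it holds for some thickening, which makes the set a union of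
  strict inequalities between continuous functions.\<close>

lemma openin_measure_less_spaceA:
  "openin spaceA {(K, z, n, r). K \<in> Kset \<and> r \<in> {0..1} \<and> measure coin (K \<inter> nbhd z n) < r + c}"
proof -
  have "openin spaceA {x \<in> topspace spaceA. (case x of (K, z, n, r) \<Rightarrow> measure coin (thick m K \<inter> nbhd z n))
      < (case x of (K, z, n, r) \<Rightarrow> r) + c}" for m
    by (intro openin_less continuous_thick_spaceA continuous_map_add continuous_radius_spaceA) simp
  then have "openin spaceA (\<Union>m. {x \<in> topspace spaceA. (case x of (K, z, n, r) \<Rightarrow> measure coin (thick m K \<inter> nbhd z n))
      < (case x of (K, z, n, r) \<Rightarrow> r) + c})" by blast
  also have "(\<Union>m. {x \<in> topspace spaceA. (case x of (K, z, n, r) \<Rightarrow> measure coin (thick m K \<inter> nbhd z n))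
      < (case x of (K, z, n, r) \<Rightarrow> r) + c}) =
      {(K, z, n, r). K \<in> Kset \<and> r \<in> {0..1} \<and> measure coin (K \<inter> nbhd z n) < r + c}"
    by (auto simp: topspace_spaceA measure_less_iff_thick)
  finally show ?thesis .
qed

lemma openin_dratio_less_spaceB:
  "openin spaceB {(K, z, r). K \<in> Kset \<and> r \<in> {0..1} \<and> dratio K z n < r + c}"
proof -
  have *: "dratio K z n < s \<longleftrightarrow> measure coin (K \<inter> nbhd z n) < s * (1/2) ^ n" for K z s
    unfolding dratio_def measure_nbhd by (rule pos_divide_less_eq) simp
  have "openin spaceB {x \<in> topspace spaceB. (case x of (K, z, r) \<Rightarrow> measure coin (thick m K \<inter> nbhd z n))
      < ((case x of (K, z, r) \<Rightarrow> r) + c) * (1/2) ^ n}" for m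
    by (intro openin_less continuous_thick_spaceB continuous_map_real_mult continuous_map_add
        continuous_radius_spaceB) simp_all
  then have "openin spaceB (\<Union>m. {x \<in> topspace spaceB. (case x of (K, z, r) \<Rightarrow> measure coin (thick m K \<inter> nbhd z n))
      < ((case x of (K, z, r) \<Rightarrow> r) + c) * (1/2) ^ n})" by blast
  also have "(\<Union>m. {x \<in> topspace spaceB. (case x of (K, z, r) \<Rightarrow> measure coin (thick m K \<inter> nbhd z n))
      < ((case x of (K, z, r) \<Rightarrow> r) + c) * (1/2) ^ n}) =
      {(K, z, r). K \<in> Kset \<and> r \<in> {0..1} \<and> dratio K z n < r + c}"
    unfolding * by (auto simp: topspace_spaceB measure_less_iff_thick)
  finally show ?thesis .
qed

section \<open>Borel classes of the sets themselves\<close>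

lemma A_le_Pi0_2: "A_le \<in> Pi0 2 spaceA"
proof -
  have "A_le = (\<Inter>j\<in>UNIV. {(K, z, n, r). K \<in> Kset \<and> r \<in> {0..1} \<and>
      measure coin (K \<inter> nbhd z n) < r + inverse (real (Suc j))})"
    unfolding A_le_def le_iff_inverse_Suc[of "measure coin _"] by auto
  also have "\<dots> \<in> Pi0 (Suc (Suc 0)) spaceA"
    by (rule Pi0_countable_Inter) (simp_all only: Sigma0.simps mem_Collect_eq openin_measure_less_spaceA
        countableI_type UNIV_not_empty not_False_eq_True)
  finally show ?thesis by (simp only: numeral_2_eq_2)
qed

lemma Sigma0_Un:
  assumes "S \<in> Sigma0 (Suc (Suc n)) X" "T \<in> Sigma0 (Suc (Suc n)) X"
  shows "S \<union> T \<in> Sigma0 (Suc (Suc n)) X"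
proof -
  obtain A B where AB: "S = (\<Union>i::nat. A i)" "\<And>i. A i \<in> Pi0 (Suc n) X"
      "T = (\<Union>i::nat. B i)" "\<And>i. B i \<in> Pi0 (Suc n) X"
    using assms unfolding Sigma0_Suc_Suc by blast
  have "(\<Union>i\<in>UNIV. case_sum A B i) \<in> Sigma0 (Suc (Suc n)) X"
    using AB(2,4) by (intro Sigma0_countable_Union) (auto split: sum.split)
  moreover have "(\<Union>i\<in>UNIV. case_sum A B i) = S \<union> T"
    unfolding AB UNIV_sum by (simp add: image_Un image_image)
  ultimately show ?thesis by simp
qed

text \<open>Equality fails through \<open><\<close> or through \<open>>\<close>. The second case is
  the complement of \<open>A_le\<close>; the first is written as a countable union of closed sets,
  so both belong to \<open>\<Sigma>\<^sup>0\<^sub>2\<close>.\<close>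

lemma A_eq_Pi0_2: "A_eq \<in> Pi0 2 spaceA"
proof -
  let ?T = "{(K, z, n, r). K \<in> Kset \<and> r \<in> {0..1} \<and> measure coin (K \<inter> nbhd z n) < r}"
  \<comment> \<open>The margin 1/(j+1) turns the strict inequality for the level \<open>m\<close>
    thickening into a closed condition.\<close>
  let ?C = "\<lambda>(m, j). {x \<in> topspace spaceA. (case x of (K, z, n, r) \<Rightarrow> measure coin (thick m K \<inter> nbhd z n))
      \<le> (case x of (K, z, n, r) \<Rightarrow> r) - inverse (real (Suc j))}"
  have "closedin spaceA (?C p)" for p
  proof -
    obtain m j where p: "p = (m, j)" by fastforce
    show ?thesis unfolding p prod.case
      by (intro closedin_le continuous_thick_spaceA continuous_map_diff continuous_radius_spaceA) simp
  qed
  then have "(\<Union>p\<in>UNIV. ?C p) \<in> Sigma0 (Suc (Suc 0)) spaceA"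
    by (intro Sigma0_countable_Union) (simp_all only: Pi0_1[unfolded One_nat_def] countableI_type
        UNIV_not_empty not_False_eq_True)
  moreover have "(\<Union>p\<in>UNIV. ?C p) = ?T"
  proof (rule set_eqI)
    fix x :: "(nat \<Rightarrow> bool) set \<times> (nat \<Rightarrow> bool) \<times> nat \<times> real"
    obtain K z n r where x: "x = (K, z, n, r)" by (cases x)
    have "measure coin (K \<inter> nbhd z n) < r \<longleftrightarrow>
        (\<exists>m j. measure coin (thick m K \<inter> nbhd z n) \<le> r - inverse (real (Suc j)))" if "K \<in> Kset"
      unfolding measure_less_iff_thick[OF that sets_nbhd] by (simp only: less_iff_inverse_Suc)
    then show "x \<in> (\<Union>p\<in>UNIV. ?C p) \<longleftrightarrow> x \<in> ?T"
      by (auto simp: x topspace_spaceA)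
  qed
  ultimately have T: "?T \<in> Sigma0 2 spaceA" by (simp only: numeral_2_eq_2)
  have "topspace spaceA - A_le \<in> Sigma0 2 spaceA" using A_le_Pi0_2 by (simp add: Pi0_iff)
  with T have "?T \<union> (topspace spaceA - A_le) \<in> Sigma0 2 spaceA"
    unfolding numeral_2_eq_2 by (rule Sigma0_Un)
  moreover have "topspace spaceA - A_eq = ?T \<union> (topspace spaceA - A_le)"
    by (auto simp: topspace_spaceA A_eq_def A_le_def)
  moreover have "A_eq \<subseteq> topspace spaceA" by (auto simp: topspace_spaceA A_eq_def)
  ultimately show ?thesis by (simp only: Pi0_iff)
qed

text \<open>For fixed \<open>j\<close> and \<open>N\<close> the condition is a union of open sets,
  and the remaining quantifiers are countable intersections. \<open>I\<close> is all of
  \<open>nat\<close> for \<open>Bm_le\<close> and a singleton for the pieces of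
  \<open>Bm_lt\<close>.\<close>

lemma infinitely_often_dratio_less_Pi0_2:
  "{(K, z, r). K \<in> Kset \<and> r \<in> {0..1} \<and> (\<forall>j\<in>I. \<forall>N. \<exists>n\<ge>N. dratio K z n < r + c j)} \<in> Pi0 2 spaceB"
  if "I \<noteq> {}" for I :: "nat set"
proof -
  let ?U = "\<lambda>(j, N). \<Union>n\<in>{N..}. {(K, z, r). K \<in> Kset \<and> r \<in> {0..1} \<and> dratio K z n < r + c j}"
  have "openin spaceB (?U p)" for p
    using openin_dratio_less_spaceB by (cases p) auto
  then have "(\<Inter>p\<in>I \<times> UNIV. ?U p) \<in> Pi0 2 spaceB"
    unfolding numeral_2_eq_2 using that by (intro Pi0_countable_Inter) auto
  also have "(\<Inter>p\<in>I \<times> UNIV. ?U p) = {(K, z, r). K \<in> Kset \<and> r \<in> {0..1} \<and> (\<forall>j\<in>I. \<forall>N. \<exists>n\<ge>N. dratio K z n < r + c j)}"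
    using that by auto
  finally show ?thesis .
qed

lemma Bm_le_Pi0_2: "Bm_le \<in> Pi0 2 spaceB"
  using infinitely_often_dratio_less_Pi0_2[where I = UNIV and c = "\<lambda>j. inverse (real (Suc j))",
      OF UNIV_not_empty]
  unfolding Bm_le_def lower_density_def liminf_le_iff_real ball_UNIV .

text \<open>A lower density below \<open>r\<close> means that for some \<open>j\<close> the ratios
  are infinitely often below r - 1/(j+1); each \<open>j\<close> gives a
  \<open>\<Pi>\<^sup>0\<^sub>2\<close> set.\<close>

lemma Bm_lt_Sigma0_3: "Bm_lt \<in> Sigma0 3 spaceB"
proof -
  have "(\<Union>j\<in>UNIV. {(K, z, r). K \<in> Kset \<and> r \<in> {0..1} \<and>
      (\<forall>i\<in>{j}. \<forall>N. \<exists>n\<ge>N. dratio K z n < r + - inverse (real (Suc i)))}) \<in> Sigma0 (Suc (Suc 1)) spaceB"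
  proof (rule Sigma0_countable_Union)
    fix j :: nat
    show "{(K, z, r). K \<in> Kset \<and> r \<in> {0..1} \<and>
        (\<forall>i\<in>{j}. \<forall>N. \<exists>n\<ge>N. dratio K z n < r + - inverse (real (Suc i)))} \<in> Pi0 (Suc 1) spaceB"
      using infinitely_often_dratio_less_Pi0_2[where I = "{j}" and c = "\<lambda>i. - inverse (real (Suc i))",
          OF insert_not_empty]
      unfolding numeral_2_eq_2 One_nat_def .
  qed simp_all
  also have "(\<Union>j\<in>UNIV. {(K, z, r). K \<in> Kset \<and> r \<in> {0..1} \<and>
      (\<forall>i\<in>{j}. \<forall>N. \<exists>n\<ge>N. dratio K z n < r + - inverse (real (Suc i)))}) = Bm_lt"
  proof -
    have "lower_density K z < ereal r \<longleftrightarrow>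
        (\<exists>j. \<forall>N. \<exists>n\<ge>N. dratio K z n < r + - inverse (real (Suc j)))" for K z r
      using le_liminf_iff_real[of r "dratio K z"] unfolding lower_density_def
      by (simp add: not_le[symmetric])
    then show ?thesis unfolding Bm_lt_def by auto
  qed
  finally show ?thesis by (simp only: numeral_3_eq_3 One_nat_def)
qed

lemma measure_le_Pi0_2:
  assumes "r \<in> {0..1}"
  shows "{K \<in> Kset. measure coin K \<le> r} \<in> Pi0 2 vietoris"
proof -
  let ?g = "\<lambda>K. (K, zero_seq, 0::nat, r)"
  let ?U = "\<lambda>j. {(K, z, n, r). K \<in> Kset \<and> r \<in> {0..1} \<and>
      measure coin (K \<inter> nbhd z n) < r + inverse (real (Suc j))}"
  \<comment> \<open>The section is a preimage under a continuous embedding, so the open sets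
    approximating \<open>A_le\<close> pull back to open sets.\<close>
  have "continuous_map vietoris spaceA ?g"
    using assms by (intro continuous_map_into_spaceA) (simp_all add: continuous_map_id[unfolded id_def])
  then have "openin vietoris {K \<in> topspace vietoris. ?g K \<in> ?U j}" for j
    using openin_measure_less_spaceA by (rule openin_continuous_map_preimage)
  then have "(\<Inter>j\<in>UNIV. {K \<in> topspace vietoris. ?g K \<in> ?U j}) \<in> Pi0 (Suc (Suc 0)) vietoris"
    by (intro Pi0_countable_Inter) (simp_all only: Sigma0.simps mem_Collect_eq
        countableI_type UNIV_not_empty not_False_eq_True)
  also have "(\<Inter>j\<in>UNIV. {K \<in> topspace vietoris. ?g K \<in> ?U j}) = {K \<in> Kset. measure coin K \<le> r}"
    unfolding le_iff_inverse_Suc[of "measure coin _"] using assms by auto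
  finally show ?thesis by (simp only: numeral_2_eq_2)
qed

theorem theorem3p2:
  shows
  "(\<forall>r z. 0 \<le> r \<and> r < 1 \<longrightarrow>
       bcomplete TYPE('z) (Pic 2) vietoris {K. (K, z, 0, r) \<in> A_le} \<and>
       bcomplete TYPE('z) (Sig 2) vietoris (Kset - {K. (K, z, 0, r) \<in> A_le}))
   \<and> bcomplete TYPE('z) (Pic 2) spaceA A_le
   \<and> bcomplete TYPE('z) (Sig 2) spaceA A_gt
   \<and> bcomplete TYPE('z) (Pic 2) spaceA A_eq
   \<and> bcomplete TYPE('z) (Pic 2) spaceB Bm_le
   \<and> bcomplete TYPE('z) (Pic 3) spaceB Bm_ge
   \<and> bcomplete TYPE('z) (Sig 2) spaceB Bm_gt
   \<and> bcomplete TYPE('z) (Sig 3) spaceB Bm_lt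
   \<and> hard TYPE('z) (Pic 3) spaceB B_eq"
proof -
  have section_le: "bcomplete TYPE('z) (Pic 2) vietoris {K. (K, z, 0, r) \<in> A_le}"
    if "0 \<le> r \<and> r < 1" for r z
  proof -
    have "{K. (K, z, 0, r) \<in> A_le} = {K \<in> Kset. measure coin K \<le> r}"
      using that by (auto simp: A_le_def)
    then show ?thesis
      using that hard_measure_le[where 'z='z, of r] measure_le_Pi0_2[of r] by (simp add: bcomplete_def)
  qed
  have A_le: "bcomplete TYPE('z) (Pic 2) spaceA A_le"
    using hard_A_le[where 'z='z] A_le_Pi0_2 by (simp add: bcomplete_def)
  have A_eq: "bcomplete TYPE('z) (Pic 2) spaceA A_eq"
    using hard_A_eq[where 'z='z] A_eq_Pi0_2 by (simp add: bcomplete_def)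
  have Bm_le: "bcomplete TYPE('z) (Pic 2) spaceB Bm_le"
    using hard_Bm_le[where 'z='z] Bm_le_Pi0_2 by (simp add: bcomplete_def)
  \<comment> \<open>The strict relations are complements inside the whole space, so their
    completeness follows from that of \<open>\<le>\<close> and \<open>\<ge>\<close>.\<close>
  have A_gt_eq: "A_gt = topspace spaceA - A_le"
    by (auto simp: topspace_spaceA A_gt_def A_le_def)
  have Bm_gt_eq: "Bm_gt = topspace spaceB - Bm_le"
    by (auto simp: topspace_spaceB Bm_gt_def Bm_le_def)
  have Bm_lt_eq: "Bm_lt = topspace spaceB - Bm_ge"
    by (auto simp: topspace_spaceB Bm_lt_def Bm_ge_def)
  have "Bm_ge \<subseteq> topspace spaceB"
    by (auto simp: topspace_spaceB Bm_ge_def)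
  \<comment> \<open>Here the class is read off from the complement \<open>Bm_lt\<close>, whereas
    hardness is proved for \<open>Bm_ge\<close> itself.\<close>
  then have Bm_ge: "bcomplete TYPE('z) (Pic 3) spaceB Bm_ge"
    using hard_Bm_ge[where 'z='z] Bm_lt_Sigma0_3 unfolding Bm_lt_eq by (simp add: bcomplete_def Pi0_iff)
  show ?thesis
    unfolding A_gt_eq Bm_gt_eq Bm_lt_eq
    using section_le bcomplete_complement[OF section_le, unfolded topspace_vietoris] A_le A_eq Bm_le Bm_ge
      bcomplete_complement[OF A_le] bcomplete_complement[OF Bm_le] bcomplete_complement[OF Bm_ge]
      hard_B_eq[where 'z='z]
    by (intro conjI allI impI)
qed

end
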